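(* Let the exponents $\theta_j^\pm$ be admissible and such that $\max_{1\le\mu\le M-1}r(\rho_\mu^-)<\min_{1\le\nu\le N-1}r(\rho_\nu^+)$, and let $\gamma>0$ lie strictly between these two numbers. Then every orbit $\Gamma_\nu^+(t)=h^{-1}(h_t(\rho_\nu^+(t))-\gamma t)$, $1\le\nu\le N-1$, and $\Gamma_\mu^-(t)=h^{-1}(h_t(\rho_\mu^-(t))-\gamma t)$, $1\le\mu\le M$, emanates from $\mathbb{R}$ orthogonally; that is, $\lim_{t\to0^+}\arg(\Gamma_j^\pm(t)-\rho_j^\pm(0))=\pi/2$ for each of these orbits.
   Context: $\mathbb{H}$ is the upper half-plane, $\log$ is the principal branch, $'$ denotes $\partial_z$. Parameters. $N\ge2$, $M\ge1$ are integers; $k_1^+<\dots<k_N^+<k_1^-<\dots<k_M^-$ are real; $b_1^+,\dots,b_N^+,b_1^-,\dots,b_M^->0$; $b^+=\sum_{j=1}^Nb_j^+$, $b^-=\sum_{j=1}^Mb_j^-$. Assume $b^+>b^-$, $\sum_{j=2}^Nb_j^+<b^-$, and $\sum_{j=\nu+1}^Nb_j^+\ne\sum_{j=1}^{\mu}b_j^-$ for all $1\le\nu\le N-1$, $1\le\mu\le M$. Time dependence. For positive exponents $\theta_2^+,\dots,\theta_{N-1}^+$, $\theta_1^-,\dots,\theta_M^-$ put, for $t\ge0$, $k_1^+(t)=k_1^+$, $k_N^+(t)=k_N^+$, $k_j^+(t)=k_N^++(k_j^+-k_N^+)e^{-\theta_j^+t}$ ($2\le j\le N-1$), $k_j^-(t)=k_N^++(k_j^--k_N^+)e^{-\theta_j^-t}$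 ($1\le j\le M$), and $$h_t(z)=\sum_{j=1}^Nb_j^+\log(z-k_j^+(t))-\sum_{j=1}^Mb_j^-\log(z-k_j^-(t)),$$ $h=h_0$; $h_t$ is extended to real points other than the $k_j^\pm(t)$ by continuity from $\mathbb{H}$. $h_t$ is univalent on $\mathbb{H}$. The zeros of $h_t'$ are simple and real: $\rho_\nu^+(t)\in(k_\nu^+(t),k_{\nu+1}^+(t))$ ($1\le\nu\le N-1$), $\rho_\mu^-(t)\in(k_\mu^-(t),k_{\mu+1}^-(t))$ ($1\le\mu\le M-1$), $\rho_M^-(t)>k_M^-(t)$. The rates are $r(\rho_j^\pm)=\lim_{t\to+\infty}\frac1t\mathrm{Re}\,h_t(\rho_j^\pm(t))$. (If $M=1$, a maximum over the empty set is $-\infty$.) Heights and strips. $y_\nu^+=\mathrm{Im}\,h_t(\rho_\nu^+(t))=\pi(\sum_{j=\nu+1}^Nb_j^+-b^-)$ and $y_\mu^-=\mathrm{Im}\,h_t(\rho_\mu^-(t))=-\pi\sum_{j=\mu+1}^Mb_j^-$ do not depend on $t$. Put $S_1^+=\{y_1^+<\mathrm{Im}\,w<\pi(b^+-b^-)\}$, $S_\nu^+=\{y_\nu^+<\mathrm{Im}\,w<y_{\nu-1}^+\}$ ($2\le\nu\le N-1$), $S_N^+=\{-\pi b^-<\mathrm{Im}\,w<y_{N-1}^+\}$, $S_1^-=\{-\pi b^-<\mathrm{Im}\,w<y_1^-\}$, $S_\mu^-=\{y_{\mu-1}^-<\mathrm{Im}\,w<y_\mu^-\}$ ($2\le\mu\le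 M$). For $1\le\nu\le N-1$, $\mu_\nu\in\{1,\dots,M\}$ is the index with $\sum_{j=1}^{\mu_\nu-1}b_j^-<\sum_{j=\nu+1}^Nb_j^+<\sum_{j=1}^{\mu_\nu}b_j^-$. Admissible exponents: (E0) $\theta_2^+\le\dots\le\theta_{N-1}^+$ and $\theta_1^-\ge\dots\ge\theta_M^-$. (E1) For $2\le\nu\le N-1$, $1\le\mu\le M$: if one of $S_\nu^+$, $S_\mu^-$ is contained in the other, then $\theta_\nu^+=\theta_\mu^-$; otherwise the exponent of the strip lying higher is strictly smaller. (E2) The $\theta_\mu^-$ with $S_\mu^-\subset S_1^+$ (i.e. $\mu>\mu_1$) are all equal and strictly smaller than $\theta_{\mu_1}^-$; the $\theta_\mu^-$ with $S_\mu^-\subset S_N^+$ (i.e. $\mu<\mu_{N-1}$) are all equal and strictly larger than $\theta_{\mu_{N-1}}^-$. For $\gamma$ as in the claim, $h_t(\rho_j^\pm(t))-\gamma t\in h(\mathbb{H})$ for $t>0$, and $h^{-1}$ is the inverse of $h:\mathbb{H}\to h(\mathbb{H})$; the orbit starts at $\Gamma_j^\pm(0)=\rho_j^\pm(0)\in\mathbb{R}$. *)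

theory Defs
  imports "HOL-Analysis.Analysis"
begin

(* The letters p and m stand for the superscripts + and -.  The families are
   indexed by {1..np} and {1..nm}; thetap is only used on {2..np - 1}, and the
   values of all families outside their index sets are irrelevant. *)
record log_data =
  np :: nat
  nm :: nat
  kp :: "nat \<Rightarrow> real"
  km :: "nat \<Rightarrow> real"
  bp :: "nat \<Rightarrow> real"
  bm :: "nat \<Rightarrow> real"
  thetap :: "nat \<Rightarrow> real"
  thetam :: "nat \<Rightarrow> real"

definition bp_total :: "log_data \<Rightarrow> real" where
  "bp_total P = (\<Sum>j=1..np P. bp P j)"

definition bm_total :: "log_data \<Rightarrow> real" where
  "bm_total P = (\<Sum>j=1..nm P. bm P j)"

definition standing_assms :: "log_data \<Rightarrow> bool" where
  "standing_assms P \<longleftrightarrow>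
     np P \<ge> 2 \<and> nm P \<ge> 1 \<and>
     strict_mono_on {1..np P} (kp P) \<and> kp P (np P) < km P 1 \<and>
     strict_mono_on {1..nm P} (km P) \<and>
     (\<forall>j\<in>{1..np P}. bp P j > 0) \<and> (\<forall>j\<in>{1..nm P}. bm P j > 0) \<and>
     bp_total P > bm_total P \<and>
     (\<Sum>j=2..np P. bp P j) < bm_total P \<and>
     (\<forall>\<nu>\<in>{1..np P - 1}. \<forall>\<mu>\<in>{1..nm P}.
        (\<Sum>j=\<nu>+1..np P. bp P j) \<noteq> (\<Sum>j=1..\<mu>. bm P j)) \<and>
     (\<forall>j\<in>{2..np P - 1}. thetap P j > 0) \<and> (\<forall>j\<in>{1..nm P}. thetam P j > 0)"

definition kp_t :: "log_data \<Rightarrow> real \<Rightarrow> nat \<Rightarrow> real" where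
  "kp_t P t j = (if j = 1 \<or> j = np P then kp P j
     else kp P (np P) + (kp P j - kp P (np P)) * exp (- thetap P j * t))"

definition km_t :: "log_data \<Rightarrow> real \<Rightarrow> nat \<Rightarrow> real" where
  "km_t P t j = kp P (np P) + (km P j - kp P (np P)) * exp (- thetam P j * t)"

definition upper_half_plane :: "complex set" where
  "upper_half_plane = {z. Im z > 0}"

definition closed_upper_half_plane :: "complex set" where
  "closed_upper_half_plane = {z. Im z \<ge> 0}"

(* Ln takes the value ln (-x) + i pi at a negative real x, which is its limit from the
   upper half-plane.  On real points the formula is therefore already the continuous
   extension of h_t from the upper half-plane; see continuous_on_h_map. *)
definition h_map :: "log_data \<Rightarrow> real \<Rightarrow> complex \<Rightarrow> complex" where
  "h_map P t z =
     (\<Sum>j=1..np P. of_real (bp P j) * Ln (z - of_real (kp_t P t j))) -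
     (\<Sum>j=1..nm P. of_real (bm P j) * Ln (z - of_real (km_t P t j)))"

(* At a real point the derivative of the extended h_t is the one taken within the closed
   upper half-plane: Ln jumps across the negative axis, so the two-sided one need not exist. *)
definition critical_point :: "log_data \<Rightarrow> real \<Rightarrow> real \<Rightarrow> bool" where
  "critical_point P t x \<longleftrightarrow>
     (h_map P t has_field_derivative 0) (at (of_real x) within closed_upper_half_plane)"

definition rhop :: "log_data \<Rightarrow> nat \<Rightarrow> real \<Rightarrow> real" where
  "rhop P \<nu> t = (THE x. kp_t P t \<nu> < x \<and> x < kp_t P t (\<nu> + 1) \<and> critical_point P t x)"

definition rhom :: "log_data \<Rightarrow> nat \<Rightarrow> real \<Rightarrow> real" where
  "rhom P \<mu> t = (THE x. km_t P t \<mu> < x \<and> (\<mu> < nm P \<longrightarrow> x < km_t P t (\<mu> + 1)) \<and>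
     critical_point P t x)"

definition rate :: "log_data \<Rightarrow> (real \<Rightarrow> real) \<Rightarrow> real" where
  "rate P \<rho> = Lim at_top (\<lambda>t. Re (h_map P t (of_real (\<rho> t))) / t)"

(* The formulas also make sense for nu = 0, nu = np P and mu = 0, where they give
   pi (b^+ - b^-), - pi b^- and - pi b^-: the outer heights of the extreme strips. *)
definition yp :: "log_data \<Rightarrow> nat \<Rightarrow> real" where
  "yp P \<nu> = pi * ((\<Sum>j=\<nu>+1..np P. bp P j) - bm_total P)"

definition ym :: "log_data \<Rightarrow> nat \<Rightarrow> real" where
  "ym P \<mu> = - pi * (\<Sum>j=\<mu>+1..nm P. bm P j)"

definition hstrip :: "real \<Rightarrow> real \<Rightarrow> complex set" where
  "hstrip a b = {w. a < Im w \<and> Im w < b}"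

definition Sp :: "log_data \<Rightarrow> nat \<Rightarrow> complex set" where
  "Sp P \<nu> = hstrip (yp P \<nu>) (yp P (\<nu> - 1))"

definition Sm :: "log_data \<Rightarrow> nat \<Rightarrow> complex set" where
  "Sm P \<mu> = hstrip (ym P (\<mu> - 1)) (ym P \<mu>)"

(* For strips neither of which contains the other, the comparisons of the lower and of the
   upper edges agree, and exactly one of the two strips lies above the other (possibly
   overlapping it). *)
definition Sp_above_Sm :: "log_data \<Rightarrow> nat \<Rightarrow> nat \<Rightarrow> bool" where
  "Sp_above_Sm P \<nu> \<mu> \<longleftrightarrow> ym P (\<mu> - 1) < yp P \<nu> \<and> ym P \<mu> < yp P (\<nu> - 1)"

definition Sm_above_Sp :: "log_data \<Rightarrow> nat \<Rightarrow> nat \<Rightarrow> bool" where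
  "Sm_above_Sp P \<mu> \<nu> \<longleftrightarrow> yp P \<nu> < ym P (\<mu> - 1) \<and> yp P (\<nu> - 1) < ym P \<mu>"

definition mu_index :: "log_data \<Rightarrow> nat \<Rightarrow> nat" where
  "mu_index P \<nu> = (THE \<mu>. \<mu> \<in> {1..nm P} \<and>
     (\<Sum>j=1..\<mu>-1. bm P j) < (\<Sum>j=\<nu>+1..np P. bp P j) \<and>
     (\<Sum>j=\<nu>+1..np P. bp P j) < (\<Sum>j=1..\<mu>. bm P j))"

definition E0 :: "log_data \<Rightarrow> bool" where
  "E0 P \<longleftrightarrow> mono_on {2..np P - 1} (thetap P) \<and> antimono_on {1..nm P} (thetam P)"

definition E1 :: "log_data \<Rightarrow> bool" where
  "E1 P \<longleftrightarrow> (\<forall>\<nu>\<in>{2..np P - 1}. \<forall>\<mu>\<in>{1..nm P}.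
     if Sp P \<nu> \<subseteq> Sm P \<mu> \<or> Sm P \<mu> \<subseteq> Sp P \<nu>
     then thetap P \<nu> = thetam P \<mu>
     else (Sp_above_Sm P \<nu> \<mu> \<longrightarrow> thetap P \<nu> < thetam P \<mu>) \<and>
          (Sm_above_Sp P \<mu> \<nu> \<longrightarrow> thetam P \<mu> < thetap P \<nu>))"

definition E2 :: "log_data \<Rightarrow> bool" where
  "E2 P \<longleftrightarrow>
     (\<forall>\<mu>\<in>{1..nm P}. Sm P \<mu> \<subseteq> Sp P 1 \<longrightarrow>
        thetam P \<mu> < thetam P (mu_index P 1) \<and>
        (\<forall>\<mu>'\<in>{1..nm P}. Sm P \<mu>' \<subseteq> Sp P 1 \<longrightarrow> thetam P \<mu>' = thetam P \<mu>)) \<and>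
     (\<forall>\<mu>\<in>{1..nm P}. Sm P \<mu> \<subseteq> Sp P (np P) \<longrightarrow>
        thetam P \<mu> > thetam P (mu_index P (np P - 1)) \<and>
        (\<forall>\<mu>'\<in>{1..nm P}. Sm P \<mu>' \<subseteq> Sp P (np P) \<longrightarrow> thetam P \<mu>' = thetam P \<mu>))"

definition admissible :: "log_data \<Rightarrow> bool" where
  "admissible P \<longleftrightarrow> E0 P \<and> E1 P \<and> E2 P"

definition orbit :: "log_data \<Rightarrow> real \<Rightarrow> (real \<Rightarrow> real) \<Rightarrow> real \<Rightarrow> complex" where
  "orbit P \<gamma> \<rho> t = (if t = 0 then of_real (\<rho> 0)
     else inv_into upper_half_plane (h_map P 0)
            (h_map P t (of_real (\<rho> t)) - of_real (\<gamma> * t)))"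

lemma Ln_has_field_derivative_closed_uhp:
  assumes "Im z \<ge> 0" "z \<noteq> 0"
  shows "(Ln has_field_derivative inverse z) (at z within closed_upper_half_plane)"
proof -
  have eq: "Ln w = Ln (- \<i> * w) + \<i> * of_real pi / 2" if "Im w \<ge> 0" "w \<noteq> 0" for w
    using that Ln_times_ii [of "- \<i> * w"] by (auto simp: mult.assoc [symmetric])
  have nz: "- \<i> * z \<notin> \<real>\<^sub>\<le>\<^sub>0"
    using assms by (auto simp: complex_nonpos_Reals_iff complex_eq_iff)
  have "((\<lambda>w. Ln (- \<i> * w) + \<i> * of_real pi / 2) has_field_derivative inverse z)
          (at z within closed_upper_half_plane)"
    using nz assms by (auto intro!: derivative_eq_intros simp: field_simps)
  then show ?thesis
  proof (rule has_field_derivative_transform_within [where d = "norm z"])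
    show "0 < norm z" "z \<in> closed_upper_half_plane"
      using assms by (auto simp: closed_upper_half_plane_def)
  next
    fix w assume "w \<in> closed_upper_half_plane" "dist w z < norm z"
    moreover from this have "w \<noteq> 0" by (auto simp: dist_norm)
    ultimately show "Ln (- \<i> * w) + \<i> * of_real pi / 2 = Ln w"
      using eq [of w] by (simp add: closed_upper_half_plane_def)
  qed
qed

lemma h_map_has_field_derivative:
  assumes z: "z \<in> closed_upper_half_plane"
    and "\<And>j. j \<in> {1..np P} \<Longrightarrow> z \<noteq> of_real (kp_t P t j)"
    and "\<And>j. j \<in> {1..nm P} \<Longrightarrow> z \<noteq> of_real (km_t P t j)"
  shows "(h_map P t has_field_derivative
           (\<Sum>j=1..np P. of_real (bp P j) / (z - of_real (kp_t P t j))) -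
           (\<Sum>j=1..nm P. of_real (bm P j) / (z - of_real (km_t P t j))))
         (at z within closed_upper_half_plane)"
proof -
  have *: "((\<lambda>w. Ln (w - of_real k)) has_field_derivative inverse (z - of_real k))
             (at z within closed_upper_half_plane)" if "z \<noteq> of_real k" for k
  proof -
    have "(\<lambda>w. w - of_real k) ` closed_upper_half_plane \<subseteq> closed_upper_half_plane"
      by (auto simp: closed_upper_half_plane_def)
    then have "(Ln has_field_derivative inverse (z - of_real k))
            (at (z - of_real k) within (\<lambda>w. w - of_real k) ` closed_upper_half_plane)"
      using Ln_has_field_derivative_closed_uhp [of "z - of_real k"] z that
      by (auto simp: closed_upper_half_plane_def intro: DERIV_subset)
    moreover have "((\<lambda>w. w - of_real k) has_field_derivative 1) (at z within closed_upper_half_plane)"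
      by (auto intro!: derivative_eq_intros)
    ultimately show ?thesis
      using DERIV_image_chain by (fastforce simp: o_def)
  qed
  show ?thesis
    unfolding h_map_def [abs_def] divide_inverse
    using assms(2,3) by (intro DERIV_diff DERIV_sum DERIV_cmult *)
qed

lemma continuous_on_h_map:
  "continuous_on (closed_upper_half_plane -
     (of_real ` kp_t P t ` {1..np P} \<union> of_real ` km_t P t ` {1..nm P})) (h_map P t)"
  unfolding continuous_on_eq_continuous_within
proof
  fix z assume z: "z \<in> closed_upper_half_plane -
     (of_real ` kp_t P t ` {1..np P} \<union> of_real ` km_t P t ` {1..nm P})"
  show "continuous (at z within closed_upper_half_plane -
     (of_real ` kp_t P t ` {1..np P} \<union> of_real ` km_t P t ` {1..nm P})) (h_map P t)"
    using z by (intro DERIV_continuous [OF DERIV_subset [OF h_map_has_field_derivative]]) auto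
qed

end

theory Submission
  imports Defs "HOL-Complex_Analysis.Conformal_Mappings"
begin

text \<open>
  Put \<open>K = k\<^sub>N\<^sup>+\<close> and regard \<open>h\<^sub>t\<close> as the complex potential of point charges
  \<open>e\<^sub>i\<close> (the \<open>b\<^sub>j\<^sup>+\<close> and the \<open>- b\<^sub>j\<^sup>-\<close>) at the real sites \<open>k\<^sub>i(t)\<close>. Positive charges
  sit at or to the left of \<open>K\<close>, negative ones to the right, and
  \<open>k\<^sub>i(t) - K = (k\<^sub>i - K) exp (- \<theta>\<^sub>i t)\<close>.

  Along a critical point \<open>\<rho>(t)\<close> the imaginary part of \<open>h\<^sub>t(\<rho>(t))\<close> is constant, so the orbit is
  the preimage under \<open>h\<close> of \<open>h(\<rho>(0)) + \<eta>(t)\<close> with the real number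
  \<open>\<eta>(t) = u(t) - u(0) - \<gamma> t\<close>, where \<open>u(t) = Re (h\<^sub>t(\<rho>(t)))\<close>. Near \<open>\<rho> = \<rho>(0)\<close> the equation
  \<open>h(z) = h(\<rho>) + \<eta>\<close> reads \<open>(z - \<rho>)\<^sup>2 \<approx> 2 \<eta> / h''(\<rho>)\<close>. The orbit therefore leaves orthogonally as soon
  as \<open>\<eta>(t)\<close> tends to \<open>0\<close> and has the sign opposite to that of \<open>h''(\<rho>)\<close>, provided that \<open>h\<close> is univalent,
  so that the preimage found near \<open>\<rho>\<close> is the only one. Both the univalence and the sign of \<open>h''(\<rho>)\<close>
  come from the product \<open>(z - a) h'(z)\<close>, where the real number \<open>a\<close> separates the positive from the negative
  charges: this product has positive imaginary part in the upper half-plane and is increasing between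
  neighbouring sites on the real line. In particular \<open>h'' < 0\<close> at the \<open>\<rho>\<^sub>\<nu>\<^sup>+\<close> and \<open>h'' > 0\<close> at the
  \<open>\<rho>\<^sub>\<mu>\<^sup>-\<close>. See \<open>inj_on_potential\<close>, \<open>efield_zero_slope\<close> and
  \<open>Arg_potential_preimage_near_critical_point\<close>.

  The sign of \<open>\<eta>\<close> is a matter of convexity. In the coordinates \<open>t\<close> and \<open>s = ln \<bar>x - K\<bar>\<close> the term \<open>ln \<bar>x - k\<^sub>i(t)\<bar>\<close> is
  \<open>ln \<bar>exp s \<mp> exp (c\<^sub>i - \<theta>\<^sub>i t)\<bar>\<close>; it is jointly concave if the site lies on the same side of \<open>K\<close> as \<open>x\<close>
  and jointly convex if it lies on the other side. With the signs of the charges, \<open>Re h\<^sub>t\<close> becomes jointly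
  concave for \<open>x < K\<close> and jointly convex for \<open>x > K\<close>. Its critical value \<open>u(t)\<close> is a maximum over \<open>s\<close> in
  the first case and a minimum in the second, hence concave respectively convex in \<open>t\<close>. So \<open>u(t) / t\<close>
  converges, the limit is the rate \<open>r\<close>, and \<open>u(t) - u(0) \<ge> r t\<close> respectively \<open>u(t) - u(0) \<le> r t\<close>
  (\<open>height_tangent\<close>, \<open>supergradient_slope\<close>, \<open>critical_height_slope\<close>). As \<open>\<gamma>\<close> lies below the
  rates of the \<open>\<rho>\<^sub>\<nu>\<^sup>+\<close> and above those of the \<open>\<rho>\<^sub>\<mu>\<^sup>-\<close> with \<open>\<mu> < M\<close>, the number \<open>\<eta>(t)\<close> has the required
  sign. For \<open>\<rho>\<^sub>M\<^sup>-\<close> the bound on the rate found in \<open>drift_bound\<close> is \<open>r \<le> 0 < \<gamma>\<close>.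
\<close>

section \<open>Tangent planes of logarithms\<close>

text \<open>Jensen's inequality for the logarithm (the log-sum inequality): the tangent plane of \<open>ln (exp \<alpha> + exp \<beta>)\<close>, with \<open>\<alpha> = ln a\<close> and \<open>\<beta> = ln b\<close>, lies below the graph.\<close>

lemma log_sum_tangent:
  fixes a b a' b' :: real
  assumes "a > 0" "b > 0" "a' > 0" "b' > 0"
  shows "a * ln (a' / a) + b * ln (b' / b) \<le> (a + b) * (ln (a' + b') - ln (a + b))"
proof -
  define s where "s = (a' + b') / (a + b)"
  have s: "s > 0" "(a + b) * s = a' + b'"
    using assms by (auto simp: s_def)
  have *: "x * ln (x' / x) - x * ln s \<le> x' / s - x" if "x > 0" "x' > 0" for x x'
  proof -
    have "ln (x' / x) - ln s = ln (x' / x / s)"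
      using that s by (simp add: ln_div ln_mult)
    also have "\<dots> \<le> x' / x / s - 1"
      using that s by (intro ln_le_minus_one) auto
    finally have "x * (ln (x' / x) - ln s) \<le> x * (x' / x / s - 1)"
      using that by (intro mult_left_mono) auto
    also have "\<dots> = x' / s - x"
      using that by (simp add: right_diff_distrib)
    finally show ?thesis
      by (simp add: right_diff_distrib)
  qed
  have "a * ln (a' / a) + b * ln (b' / b) - (a + b) * ln s \<le> (a' + b') / s - (a + b)"
    using *[of a a'] *[of b b'] assms by (simp add: add_divide_distrib algebra_simps)
  also have "(a' + b') / s = a + b"
    using s by (simp add: field_simps)
  finally show ?thesis
    using assms by (simp add: s_def ln_div)
qed

text \<open>The number \<open>D\<close> is the gap between \<open>ln \<bar>v - \<sigma>\<bar>\<close>, seen as a function of \<open>ln \<bar>v\<bar>\<close> and \<open>ln \<bar>\<sigma>\<bar>\<close>, and its tangent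
  plane. For opposite signs of \<open>v\<close> and \<open>\<sigma>\<close> the function is \<open>ln (exp \<alpha> + exp \<beta>)\<close>, which is convex. For
  equal signs it is \<open>ln \<bar>exp \<alpha> - exp \<beta>\<bar>\<close>, which is concave: the larger of \<open>\<bar>v\<bar>\<close> and \<open>\<bar>\<sigma>\<bar>\<close> is the sum of the other
  one and of \<open>\<bar>v - \<sigma>\<bar>\<close>, so that the log-sum inequality can be solved for the increment of \<open>ln \<bar>v - \<sigma>\<bar>\<close>.\<close>

lemma ln_abs_diff_tangent:
  fixes v v' \<sigma> d :: real
  defines "D \<equiv> ln \<bar>v' - \<sigma> * exp d\<bar> - ln \<bar>v - \<sigma>\<bar> - (v * ln (v' / v) - \<sigma> * d) / (v - \<sigma>)"
  assumes "v * v' > 0" and "(v - \<sigma>) * (v' - \<sigma> * exp d) > 0"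
  shows "\<sigma> * v * D \<le> 0" and "\<sigma> = 0 \<Longrightarrow> D = 0"
proof -
  have pos: "(\<sigma> > 0 \<longrightarrow> E \<le> 0) \<and> (\<sigma> < 0 \<longrightarrow> E \<ge> 0) \<and> (\<sigma> = 0 \<longrightarrow> E = 0)"
    if v: "v > 0" "v' > 0" "(v - \<sigma>) * (v' - \<sigma> * exp d) > 0"
      and E: "E = ln \<bar>v' - \<sigma> * exp d\<bar> - ln \<bar>v - \<sigma>\<bar> - (v * ln (v' / v) - \<sigma> * d) / (v - \<sigma>)"
    for v v' \<sigma> E :: real
  proof -
    consider "\<sigma> = 0" | "\<sigma> < 0" | "0 < \<sigma>" "\<sigma> < v" | "v < \<sigma>"
      using v(3) by (cases "\<sigma> = v") (auto, linarith)
    then show ?thesis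
    proof cases
      case 1
      then show ?thesis
        using v E by (simp add: ln_div)
    next
      case 2
      then have pos': "- \<sigma> * exp d > 0" "v - \<sigma> > 0"
        using v by (auto simp: mult_less_0_iff)
      then have "v * ln (v' / v) + (- \<sigma>) * ln ((- \<sigma> * exp d) / (- \<sigma>))
               \<le> (v + - \<sigma>) * (ln (v' + - \<sigma> * exp d) - ln (v + - \<sigma>))"
        using 2 v by (intro log_sum_tangent) auto
      then have "v * ln (v' / v) - \<sigma> * d \<le> (ln (v' - \<sigma> * exp d) - ln (v - \<sigma>)) * (v - \<sigma>)"
        using 2 by (simp add: mult.commute)
      then have "(v * ln (v' / v) - \<sigma> * d) / (v - \<sigma>) \<le> ln (v' - \<sigma> * exp d) - ln (v - \<sigma>)"
        using pos'(2) by (simp only: pos_divide_le_eq)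
      moreover have "v' - \<sigma> * exp d > 0"
        using pos' v by simp
      ultimately show ?thesis
        using 2 pos' by (simp add: E abs_of_pos)
    next
      case 3
      then have pos': "v - \<sigma> > 0" "v' - \<sigma> * exp d > 0"
        using v(3) by (auto simp: zero_less_mult_iff)
      then have "(v - \<sigma>) * ln ((v' - \<sigma> * exp d) / (v - \<sigma>)) + \<sigma> * ln (\<sigma> * exp d / \<sigma>)
               \<le> (v - \<sigma> + \<sigma>) * (ln (v' - \<sigma> * exp d + \<sigma> * exp d) - ln (v - \<sigma> + \<sigma>))"
        using 3 by (intro log_sum_tangent) auto
      then have "(ln (v' - \<sigma> * exp d) - ln (v - \<sigma>)) * (v - \<sigma>) \<le> v * ln (v' / v) - \<sigma> * d"
        using 3(1) v(1,2) pos' by (simp add: ln_div mult.commute)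
      then have "ln (v' - \<sigma> * exp d) - ln (v - \<sigma>) \<le> (v * ln (v' / v) - \<sigma> * d) / (v - \<sigma>)"
        using pos'(1) by (simp only: pos_le_divide_eq)
      then show ?thesis
        using 3(1) pos' by (simp add: E abs_of_pos)
    next
      case 4
      then have pos': "\<sigma> - v > 0" "\<sigma> * exp d - v' > 0" "\<sigma> > 0"
        using v by (auto simp: zero_less_mult_iff)
      then have "(\<sigma> - v) * ln ((\<sigma> * exp d - v') / (\<sigma> - v)) + v * ln (v' / v)
               \<le> (\<sigma> - v + v) * (ln (\<sigma> * exp d - v' + v') - ln (\<sigma> - v + v))"
        using v by (intro log_sum_tangent) auto
      then have "(ln (\<sigma> * exp d - v') - ln (\<sigma> - v)) * (\<sigma> - v) \<le> \<sigma> * d - v * ln (v' / v)"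
        using pos' by (simp add: ln_div ln_mult mult.commute)
      then have "ln (\<sigma> * exp d - v') - ln (\<sigma> - v) \<le> (\<sigma> * d - v * ln (v' / v)) / (\<sigma> - v)"
        using pos'(1) by (simp only: pos_le_divide_eq)
      also have "\<dots> = (v * ln (v' / v) - \<sigma> * d) / (v - \<sigma>)"
        by (subst minus_divide_divide[symmetric]) simp
      finally show ?thesis
        using pos' by (simp add: E abs_of_neg)
    qed
  qed
  show "\<sigma> * v * D \<le> 0" and "\<sigma> = 0 \<Longrightarrow> D = 0"
  proof -
    have "((v > 0 \<longleftrightarrow> \<sigma> > 0) \<longrightarrow> \<sigma> \<noteq> 0 \<longrightarrow> D \<le> 0) \<and> ((v > 0 \<longleftrightarrow> \<sigma> < 0) \<longrightarrow> \<sigma> \<noteq> 0 \<longrightarrow> D \<ge> 0) \<and> (\<sigma> = 0 \<longrightarrow> D = 0)"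
    proof (cases "v > 0")
      case True
      then have "v' > 0"
        using assms(2) by (simp add: zero_less_mult_iff)
      from pos[OF True this assms(3) D_def[THEN meta_eq_to_obj_eq]] True show ?thesis
        by linarith
    next
      case False
      have eq: "D = ln \<bar>- v' - - \<sigma> * exp d\<bar> - ln \<bar>- v - - \<sigma>\<bar> - (- v * ln (- v' / - v) - - \<sigma> * d) / (- v - - \<sigma>)"
      proof -
        have "\<bar>- v' - - \<sigma> * exp d\<bar> = \<bar>v' - \<sigma> * exp d\<bar>" "\<bar>- v - - \<sigma>\<bar> = \<bar>v - \<sigma>\<bar>"
          by linarith+
        moreover have "(- v * ln (- v' / - v) - - \<sigma> * d) / (- v - - \<sigma>) = (v * ln (v' / v) - \<sigma> * d) / (v - \<sigma>)"
          by (subst minus_divide_divide[symmetric]) (simp add: algebra_simps)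
        ultimately show ?thesis
          unfolding D_def by simp
      qed
      have "- v > 0" "- v' > 0"
        using assms(2) False by (auto simp: zero_less_mult_iff)
      moreover have "(- v - - \<sigma>) * (- v' - - \<sigma> * exp d) > 0"
        using assms(3) by (simp add: algebra_simps)
      ultimately show ?thesis
        using pos[OF _ _ _ eq] False by linarith
    qed
    moreover have "v \<noteq> 0"
      using assms(2) by auto
    ultimately show "\<sigma> * v * D \<le> 0" and "\<sigma> = 0 \<Longrightarrow> D = 0"
      by (cases \<sigma> "0 :: real" rule: linorder_cases; cases v "0 :: real" rule: linorder_cases;
          simp add: mult_le_0_iff zero_le_mult_iff)+
  qed
qed

section \<open>Slopes of concave functions\<close>

text \<open>A function with a supergradient at every point is concave, so that its slopes from \<open>0\<close> decrease; being
  bounded below by \<open>- C\<close>, they converge to their infimum \<open>L\<close>. Squeezing \<open>u\<close> between the lines of slope \<open>L\<close> and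
  \<open>s 0\<close> through its value at \<open>0\<close> gives continuity there.\<close>

lemma supergradient_slope:
  fixes u s :: "real \<Rightarrow> real"
  assumes super: "\<And>t t'. t \<ge> 0 \<Longrightarrow> t' \<ge> 0 \<Longrightarrow> u t' \<le> u t + s t * (t' - t)"
    and lower: "\<And>t. t \<ge> 0 \<Longrightarrow> s t \<ge> - C"
  obtains L where "((\<lambda>t. u t / t) \<longlongrightarrow> L) at_top"
    and "\<forall>t\<ge>0. u t - u 0 \<ge> L * t"
    and "L \<ge> - C"
    and "(u \<longlongrightarrow> u 0) (at_right 0)"
proof -
  define q where "q t = (u t - u 0) / t" for t
  have q_ge_s: "s t \<le> q t" if "t > 0" for t
    using super[of t 0] that by (simp add: q_def field_simps)
  have q_lower: "- C \<le> q t" if "t > 0" for t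
    using q_ge_s[OF that] lower[of t] that by simp
  have q_anti: "q t' \<le> q t" if "0 < t" "t \<le> t'" for t t'
  proof -
    have "u t' - u t \<le> s t * (t' - t)"
      using super[of t t'] that by simp
    also have "\<dots> \<le> q t * (t' - t)"
      using q_ge_s[of t] that by (intro mult_right_mono) auto
    finally have "u t' - u 0 \<le> q t * t'"
      using that by (simp add: q_def field_simps)
    then show ?thesis
      using that by (simp add: q_def field_simps)
  qed
  define L where "L = Inf (q ` {0<..})"
  have bdd: "bdd_below (q ` {0<..})"
    using q_lower by (intro bdd_belowI[of _ "- C"]) auto
  have L_le: "L \<le> q t" if "t > 0" for t
    unfolding L_def using that by (intro cInf_lower bdd) auto
  have L_ge: "L \<ge> - C"
    unfolding L_def using q_lower by (intro cInf_greatest) auto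
  have "(q \<longlongrightarrow> L) at_top"
  proof (rule order_tendstoI)
    fix y assume "y < L"
    then show "\<forall>\<^sub>F t in at_top. y < q t"
      by (intro eventually_at_top_linorderI[of 1] less_le_trans[OF _ L_le]) auto
  next
    fix y assume "L < y"
    then obtain t0 where "t0 > 0" "q t0 < y"
      unfolding L_def by (subst (asm) cInf_less_iff) (auto intro: bdd)
    then show "\<forall>\<^sub>F t in at_top. q t < y"
      by (intro eventually_at_top_linorderI[of t0] le_less_trans[OF q_anti \<open>q t0 < y\<close>]) auto
  qed
  moreover have "((\<lambda>t. u 0 / t) \<longlongrightarrow> 0) at_top"
    by (intro tendsto_divide_0[OF tendsto_const] filterlim_at_top_imp_at_infinity filterlim_ident)
  ultimately have "((\<lambda>t. q t + u 0 / t) \<longlongrightarrow> L + 0) at_top"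
    by (rule tendsto_add)
  moreover have "q t + u 0 / t = u t / t" for t
    by (simp add: q_def diff_divide_distrib)
  ultimately have lim: "((\<lambda>t. u t / t) \<longlongrightarrow> L) at_top"
    by simp
  have incr: "u t - u 0 \<ge> L * t" if "t \<ge> 0" for t
    using L_le[of t] that by (cases "t = 0") (auto simp: q_def field_simps)
  have "(u \<longlongrightarrow> u 0) (at_right 0)"
  proof (rule tendsto_sandwich)
    show "\<forall>\<^sub>F t in at_right 0. u 0 + L * t \<le> u t"
    proof (rule eventually_at_right_less[THEN eventually_mono])
      fix t :: real assume "0 < t"
      then show "u 0 + L * t \<le> u t"
        using incr[of t] by simp
    qed
    show "\<forall>\<^sub>F t in at_right 0. u t \<le> u 0 + s 0 * t"
    proof (rule eventually_at_right_less[THEN eventually_mono])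
      fix t :: real assume "0 < t"
      then show "u t \<le> u 0 + s 0 * t"
        using super[of 0 t] by simp
    qed
    show "((\<lambda>t. u 0 + L * t) \<longlongrightarrow> u 0) (at_right 0)" "((\<lambda>t. u 0 + s 0 * t) \<longlongrightarrow> u 0) (at_right 0)"
      by (auto intro!: tendsto_eq_intros)
  qed
  with lim incr L_ge that show ?thesis by blast
qed

section \<open>Point charges on the real line\<close>

definition potential :: "'i set \<Rightarrow> ('i \<Rightarrow> real) \<Rightarrow> ('i \<Rightarrow> real) \<Rightarrow> complex \<Rightarrow> complex" where
  "potential I e k z = (\<Sum>i\<in>I. of_real (e i) * Ln (z - of_real (k i)))"

text \<open>The derivative of the potential; its critical points are the zeros of this rational function. The type is
  left open because real points are treated over the reals and univalence over the complex numbers.\<close>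

definition efield :: "'i set \<Rightarrow> ('i \<Rightarrow> real) \<Rightarrow> ('i \<Rightarrow> real) \<Rightarrow> 'a \<Rightarrow> 'a::real_normed_field" where
  "efield I e k x = (\<Sum>i\<in>I. of_real (e i) / (x - of_real (k i)))"

lemma efield_of_real: "efield I e k (of_real x) = of_real (efield I e k x)"
  by (simp add: efield_def)

text \<open>Positive charges to the left of \<open>a\<close>, negative ones to the right. Multiplying the field by \<open>x - a\<close> then makes
  all residues negative.\<close>

locale separated_charges =
  fixes I :: "'i set" and e k :: "'i \<Rightarrow> real" and a :: real
  assumes finite_I: "finite I" and nonempty_I: "I \<noteq> {}"
    and sep: "\<And>i. i \<in> I \<Longrightarrow> e i * (k i - a) < 0"
begin

lemma weighted_efield:
  fixes x :: "'a::real_normed_field"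
  assumes "\<And>i. i \<in> I \<Longrightarrow> x \<noteq> of_real (k i)"
  shows "(x - of_real a) * efield I e k x =
           of_real (\<Sum>i\<in>I. e i) + (\<Sum>i\<in>I. of_real (e i * (k i - a)) / (x - of_real (k i)))"
proof -
  have "(x - of_real a) * (of_real (e i) / (x - of_real (k i)))
         = of_real (e i) + of_real (e i * (k i - a)) / (x - of_real (k i))" if "i \<in> I" for i
    using assms[OF that] by (simp add: field_simps)
  then show ?thesis
    by (simp add: efield_def sum_distrib_left sum.distrib)
qed

lemma weighted_efield_term_less:
  assumes "i \<in> I" "x < y" "(x - k i) * (y - k i) > 0"
  shows "e i * (k i - a) / (x - k i) < e i * (k i - a) / (y - k i)"
proof -
  have "inverse (y - k i) < inverse (x - k i)"
    using assms by (auto simp: zero_less_mult_iff intro: less_imp_inverse_less less_imp_inverse_less_neg)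
  then show ?thesis
    using sep[OF assms(1)] unfolding divide_inverse by (rule mult_strict_left_mono_neg)
qed

lemma weighted_efield_strict_mono:
  fixes x y :: real
  assumes "x < y" "\<And>i. i \<in> I \<Longrightarrow> (x - k i) * (y - k i) > 0"
  shows "(x - a) * efield I e k x < (y - a) * efield I e k y"
proof -
  have "x \<noteq> k i \<and> y \<noteq> k i" if "i \<in> I" for i
    using assms(2)[OF that] by auto
  then show ?thesis
    using weighted_efield[of x] weighted_efield[of y] assms
      sum_strict_mono[OF finite_I nonempty_I, of "\<lambda>i. e i * (k i - a) / (x - k i)" "\<lambda>i. e i * (k i - a) / (y - k i)"]
      weighted_efield_term_less by simp
qed

lemma efield_zero_unique:
  fixes x y :: real
  assumes "efield I e k x = 0" "efield I e k y = 0" "\<And>i. i \<in> I \<Longrightarrow> (x - k i) * (y - k i) > 0"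
  shows "x = y"
  using weighted_efield_strict_mono[of x y] weighted_efield_strict_mono[of y x] assms
  by (cases x y rule: linorder_cases) (auto simp: mult.commute)

text \<open>At the right of a site the term of that site tends to minus infinity. The other terms increase up to the
  point \<open>m\<close>, so that their values at \<open>m\<close> bound them.\<close>

lemma weighted_efield_neg_right_of_pole:
  assumes "i0 \<in> I" "k i0 < m" "\<And>i. i \<in> I - {i0} \<Longrightarrow> k i < k i0 \<or> m < k i"
  obtains x where "k i0 < x" "x < m" "(x - a) * efield I e k x < 0"
proof -
  define R where "R = (\<Sum>i\<in>I. e i) + (\<Sum>i\<in>I-{i0}. e i * (k i - a) / (m - k i))"
  define C where "C = - (e i0 * (k i0 - a))"
  have C: "C > 0"
    using sep[OF assms(1)] by (simp add: C_def)
  \<comment> \<open>Close enough to the site for its own term, which is minus \<open>C\<close> over the distance, to outweigh \<open>R\<close>.\<close>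
  define x where "x = k i0 + min ((m - k i0) / 2) (C / (\<bar>R\<bar> + 1))"
  have x: "k i0 < x" "x < m"
    using C assms(2) by (auto simp: x_def min_def divide_less_eq field_simps)
  have "(\<Sum>i\<in>I-{i0}. e i * (k i - a) / (x - k i)) \<le> (\<Sum>i\<in>I-{i0}. e i * (k i - a) / (m - k i))"
  proof (rule sum_mono)
    fix i assume i: "i \<in> I - {i0}"
    then have "(x - k i) * (m - k i) > 0"
      using assms(3)[OF i] x by (auto simp: zero_less_mult_iff)
    then show "e i * (k i - a) / (x - k i) \<le> e i * (k i - a) / (m - k i)"
      using weighted_efield_term_less[of i x m] i x by auto
  qed
  moreover have "x \<noteq> k i" if "i \<in> I" for i
    using x assms(3)[of i] that by (cases "i = i0") auto
  ultimately have "(x - a) * efield I e k x \<le> R + e i0 * (k i0 - a) / (x - k i0)"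
    using weighted_efield[of x] finite_I assms(1) by (simp add: R_def sum.remove[of I i0])
  also have "\<dots> < 0"
  proof -
    have "x - k i0 \<le> C / (\<bar>R\<bar> + 1)"
      by (simp add: x_def)
    then have "(\<bar>R\<bar> + 1) * (x - k i0) \<le> C"
      by (simp add: pos_le_divide_eq mult.commute)
    then have "\<bar>R\<bar> + 1 \<le> C / (x - k i0)"
      using x by (simp add: pos_le_divide_eq)
    moreover have "e i0 * (k i0 - a) / (x - k i0) = - (C / (x - k i0))"
      by (simp add: C_def)
    ultimately show ?thesis
      by linarith
  qed
  finally show ?thesis
    using that x by blast
qed

text \<open>The reflection \<open>x \<mapsto> - x\<close> exchanges the two sides of a site.\<close>

lemma reflected: "separated_charges I (\<lambda>i. - e i) (\<lambda>i. - k i) (- a)"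
  using finite_I nonempty_I sep by unfold_locales (auto simp: algebra_simps)

lemma weighted_efield_pos_left_of_pole:
  assumes "i0 \<in> I" "m < k i0" "\<And>i. i \<in> I - {i0} \<Longrightarrow> k i < m \<or> k i0 < k i"
  obtains x where "m < x" "x < k i0" "(x - a) * efield I e k x > 0"
proof -
  interpret refl: separated_charges I "\<lambda>i. - e i" "\<lambda>i. - k i" "- a"
    by (rule reflected)
  obtain x where x: "- k i0 < x" "x < - m" "(x - - a) * efield I (\<lambda>i. - e i) (\<lambda>i. - k i) x < 0"
  proof (rule refl.weighted_efield_neg_right_of_pole[of i0 "- m"])
    show "- k i < - k i0 \<or> - m < - k i" if "i \<in> I - {i0}" for i
      using assms(3)[OF that] by linarith
  qed (use assms in auto)
  have "efield I (\<lambda>i. - e i) (\<lambda>i. - k i) x = efield I e k (- x)"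
    unfolding efield_def
    by (intro sum.cong refl, subst minus_divide_divide[symmetric]) (simp add: algebra_simps)
  with x have "(- x - a) * efield I e k (- x) > 0"
    by (simp add: mult_less_0_iff zero_less_mult_iff) argo
  with x that[of "- x"] show ?thesis
    by simp
qed

lemma efield_zero_between:
  fixes x y :: real
  assumes "x < y" "(x - a) * efield I e k x < 0" "(y - a) * efield I e k y > 0"
    and "\<And>i. i \<in> I \<Longrightarrow> k i < x \<or> y < k i" and "a < x \<or> y < a"
  obtains z where "x < z" "z < y" "efield I e k z = 0"
proof -
  have "continuous_on {x..y} (\<lambda>z. (z - a) * efield I e k z)"
    unfolding efield_def of_real_eq_id id_def using assms(4) by (intro continuous_intros) fastforce
  with assms(1-3) obtain z where z: "x \<le> z" "z \<le> y" "(z - a) * efield I e k z = 0"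
    using IVT'[of "\<lambda>z. (z - a) * efield I e k z" x 0 y] by auto
  with assms(2,3,5) have "efield I e k z = 0" "z \<noteq> x" "z \<noteq> y"
    by auto
  with z that[of z] show ?thesis
    by (simp add: less_le)
qed

lemma efield_zero_between_poles:
  assumes "i0 \<in> I" "i1 \<in> I" "k i0 < k i1" "inj_on k I"
    and "\<And>i. i \<in> I \<Longrightarrow> k i \<le> k i0 \<or> k i1 \<le> k i" and "a \<le> k i0 \<or> k i1 \<le> a"
  obtains x where "k i0 < x" "x < k i1" "efield I e k x = 0"
proof -
  \<comment> \<open>Any point strictly between the two sites separates the point with a negative value from the one with a positive value.\<close>
  define m where "m = (k i0 + k i1) / 2"
  have m: "k i0 < m" "m < k i1"
    using assms(3) by (auto simp: m_def)
  have strict: "k i < k i0 \<or> k i1 < k i" if "i \<in> I - {i0, i1}" for i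
    using assms(5)[of i] that inj_onD[OF assms(4), of i] assms(1,2) by (metis DiffE insertCI less_le)
  have 0: "k i < k i0 \<or> m < k i" if "i \<in> I - {i0}" for i
    using strict[of i] that m by (cases "i = i1") auto
  have 1: "k i < m \<or> k i1 < k i" if "i \<in> I - {i1}" for i
    using strict[of i] that m by (cases "i = i0") auto
  obtain x where x: "k i0 < x" "x < m" "(x - a) * efield I e k x < 0"
    using weighted_efield_neg_right_of_pole[OF assms(1) m(1) 0] by blast
  obtain y where y: "m < y" "y < k i1" "(y - a) * efield I e k y > 0"
    using weighted_efield_pos_left_of_pole[OF assms(2) m(2) 1] by blast
  have "k i < x \<or> y < k i" if "i \<in> I" for i
    using assms(5)[OF that] x y by auto
  moreover have "a < x \<or> y < a"
    using assms(6) x y by auto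
  moreover have "x < y"
    using x y by simp
  ultimately obtain z where "x < z" "z < y" "efield I e k z = 0"
    using efield_zero_between x(3) y(3) by blast
  with x y that[of z] show ?thesis
    by simp
qed

lemma efield_zero_right_of_poles:
  assumes "i0 \<in> I" "inj_on k I" "\<And>i. i \<in> I \<Longrightarrow> k i \<le> k i0" "a \<le> k i0" "(\<Sum>i\<in>I. e i) > 0"
  obtains x where "k i0 < x" "efield I e k x = 0"
proof -
  have strict: "k i < k i0" if "i \<in> I - {i0}" for i
    using assms(3)[of i] that inj_onD[OF assms(2), of i i0] assms(1) by (metis DiffE insertCI less_le)
  obtain x where x: "k i0 < x" "(x - a) * efield I e k x < 0"
    using weighted_efield_neg_right_of_pole[of i0 "k i0 + 1"] assms(1) strict by (metis less_add_one)
  have "((\<lambda>y. e i * (k i - a) / (y - k i)) \<longlongrightarrow> 0) at_top" for i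
    by (intro tendsto_divide_0[OF tendsto_const] filterlim_at_top_imp_at_infinity
        filterlim_tendsto_add_at_top[where f = "\<lambda>_. - k i" and c = "- k i", simplified] filterlim_ident)
  then have "((\<lambda>y. (\<Sum>i\<in>I. e i) + (\<Sum>i\<in>I. e i * (k i - a) / (y - k i))) \<longlongrightarrow> (\<Sum>i\<in>I. e i) + (\<Sum>i\<in>I. 0)) at_top"
    by (intro tendsto_intros)
  with assms(5) have "\<forall>\<^sub>F y in at_top. (\<Sum>i\<in>I. e i) + (\<Sum>i\<in>I. e i * (k i - a) / (y - k i)) > 0"
    by (intro order_tendstoD) auto
  from eventually_happens[OF eventually_conj[OF eventually_gt_at_top[of x] this]]
  obtain y where y: "x < y" "(\<Sum>i\<in>I. e i) + (\<Sum>i\<in>I. e i * (k i - a) / (y - k i)) > 0"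
    by auto
  have not_pole: "y \<noteq> k i" if "i \<in> I" for i
    using assms(3)[OF that] x y by simp
  have "(y - a) * efield I e k y > 0"
    using weighted_efield[of y] y not_pole by simp
  moreover have "k i < x \<or> y < k i" if "i \<in> I" for i
    using assms(3)[OF that] x by auto
  ultimately obtain z where "x < z" "z < y" "efield I e k z = 0"
    using efield_zero_between[of x y] x y assms(4) by (metis order.strict_trans1)
  with x that[of z] show ?thesis
    by simp
qed

text \<open>The sum is minus the derivative of the field, that is \<open>- h''(\<rho>)\<close>. At a zero of the field, \<open>(\<rho> - a) h''(\<rho>)\<close> is
  the derivative of the increasing function \<open>(x - a) h'(x)\<close>.\<close>

lemma efield_zero_slope:
  assumes "efield I e k \<rho> = 0" "\<And>i. i \<in> I \<Longrightarrow> \<rho> \<noteq> k i"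
  shows "(\<rho> - a) * (\<Sum>i\<in>I. e i / (\<rho> - k i)\<^sup>2) < 0"
    (is "?l < 0")
proof -
  have "(\<rho> - a) * (e i / (\<rho> - k i)\<^sup>2) = e i / (\<rho> - k i) + e i * (k i - a) / (\<rho> - k i)\<^sup>2" if "i \<in> I" for i
    using assms(2)[OF that] by (simp add: divide_simps power2_eq_square) (simp add: algebra_simps)
  then have "?l = efield I e k \<rho> + (\<Sum>i\<in>I. e i * (k i - a) / (\<rho> - k i)\<^sup>2)"
    by (simp add: efield_def sum_distrib_left sum.distrib)
  moreover have "(\<Sum>i\<in>I. e i * (k i - a) / (\<rho> - k i)\<^sup>2) < (\<Sum>i\<in>I. 0)"
    using sep assms(2) by (intro sum_strict_mono finite_I nonempty_I) (simp add: divide_neg_pos)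
  ultimately show ?thesis
    using assms(1) by simp
qed

text \<open>Each \<open>1 / (z - k)\<close> has negative imaginary part in the upper half-plane, and all residues are negative.\<close>

lemma weighted_efield_Im_pos:
  assumes "Im z > 0"
  shows "Im ((z - of_real a) * efield I e k z) > 0"
proof -
  have "(\<Sum>i\<in>I. 0) < (\<Sum>i\<in>I. Im (of_real (e i * (k i - a)) / (z - of_real (k i))))"
  proof (intro sum_strict_mono finite_I nonempty_I)
    fix i assume i: "i \<in> I"
    define w where "w = z - of_real (k i)"
    have "Im w > 0" "w \<noteq> 0"
      using assms by (auto simp: w_def complex_eq_iff)
    then have "- (e i * (k i - a)) * Im w / (cmod w)\<^sup>2 > 0"
      using sep[OF i] by (intro divide_pos_pos mult_pos_pos) auto
    moreover have "Im (of_real c / w) = - c * Im w / (cmod w)\<^sup>2" for c :: real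
      by (simp add: Im_divide cmod_power2)
    ultimately show "0 < Im (of_real (e i * (k i - a)) / (z - of_real (k i)))"
      by (simp only: w_def)
  qed
  moreover have "z \<noteq> of_real (k i)" for i
    using assms by (auto simp: complex_eq_iff)
  ultimately show ?thesis
    by (simp add: weighted_efield)
qed

end

section \<open>Univalence and preimages near a critical point\<close>

text \<open>Near a simple critical point, \<open>f - f \<xi>\<close> is the square of a local coordinate \<open>\<psi>\<close> with \<open>2 \<psi>'(\<xi>)\<^sup>2 = f''(\<xi>)\<close>.
  The curve \<open>Z\<close> is the preimage under \<open>\<psi>\<close> of the ray in the direction \<open>\<i> \<psi>'(\<xi>)\<close>; it leaves \<open>\<xi>\<close> vertically
  whichever square root \<open>\<psi>\<close> is, and on it \<open>f - f \<xi>\<close> is \<open>- f''(\<xi>) / 2\<close> times a positive number.\<close>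

lemma simple_critical_point_preimage:
  assumes holf: "f holomorphic_on S" and S: "open S" "\<xi> \<in> S"
    and crit: "deriv f \<xi> = 0" "deriv (deriv f) \<xi> \<noteq> 0"
  obtains Z :: "real \<Rightarrow> complex" where
    "\<forall>\<^sub>F s in at_right 0. f (Z s) = f \<xi> - deriv (deriv f) \<xi> / 2 * of_real s ^ 2"
    "((\<lambda>s. (Z s - \<xi>) / of_real s) \<longlongrightarrow> \<i>) (at_right 0)"
proof -
  obtain g r where r: "0 < r" and holg: "g holomorphic_on ball \<xi> r"
    and feq: "\<And>w. w \<in> ball \<xi> r \<Longrightarrow> f w - f \<xi> = ((w - \<xi>) * g w) ^ 2"
    and gne: "\<And>w. w \<in> ball \<xi> r \<Longrightarrow> g w \<noteq> 0"
  proof (rule holomorphic_factor_order_of_zero_strong[OF holf S, of 2])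
    show "(deriv ^^ 2) f \<xi> \<noteq> 0"
      using crit by (simp add: numeral_2_eq_2)
    show "(deriv ^^ i) f \<xi> = 0" if "0 < i" "i < 2" for i
    proof -
      have "i = 1" using that by simp
      then show ?thesis using crit by simp
    qed
  qed auto
  define \<psi> where "\<psi> w = (w - \<xi>) * g w" for w
  have hol\<psi>: "\<psi> holomorphic_on ball \<xi> r"
    unfolding \<psi>_def by (intro holomorphic_intros holg)
  have \<xi>: "\<xi> \<in> ball \<xi> r"
    using r by simp
  have d\<psi>: "deriv \<psi> \<xi> = g \<xi>"
  proof (rule DERIV_imp_deriv)
    have "(g has_field_derivative deriv g \<xi>) (at \<xi>)"
      by (rule holomorphic_derivI[OF holg open_ball \<xi>])
    then show "(\<psi> has_field_derivative g \<xi>) (at \<xi>)"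
      unfolding \<psi>_def by (auto intro!: derivative_eq_intros)
  qed
  have df: "deriv f w = 2 * \<psi> w * deriv \<psi> w" if "w \<in> ball \<xi> r" for w
  proof (rule DERIV_imp_deriv)
    have "(\<psi> has_field_derivative deriv \<psi> w) (at w)"
      by (rule holomorphic_derivI[OF hol\<psi> open_ball that])
    then have "((\<lambda>w. f \<xi> + \<psi> w ^ 2) has_field_derivative 2 * \<psi> w * deriv \<psi> w) (at w)"
      by (auto intro!: derivative_eq_intros)
    then show "(f has_field_derivative 2 * \<psi> w * deriv \<psi> w) (at w)"
    proof (rule has_field_derivative_transform_within_open[OF _ open_ball that])
      show "f \<xi> + \<psi> x ^ 2 = f x" if "x \<in> ball \<xi> r" for x
        using feq[OF that] by (simp add: \<psi>_def algebra_simps)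
    qed
  qed
  have ddf: "deriv (deriv f) \<xi> = 2 * g \<xi> ^ 2"
  proof (rule DERIV_imp_deriv)
    have "(\<psi> has_field_derivative deriv \<psi> \<xi>) (at \<xi>)"
      by (rule holomorphic_derivI[OF hol\<psi> open_ball \<xi>])
    moreover have "(deriv \<psi> has_field_derivative deriv (deriv \<psi>) \<xi>) (at \<xi>)"
      by (rule holomorphic_derivI[OF holomorphic_deriv[OF hol\<psi> open_ball] open_ball \<xi>])
    ultimately have "((\<lambda>w. 2 * \<psi> w * deriv \<psi> w) has_field_derivative 2 * g \<xi> ^ 2) (at \<xi>)"
      by (auto intro!: derivative_eq_intros simp: d\<psi> power2_eq_square) (simp add: \<psi>_def)
    then show "(deriv f has_field_derivative 2 * g \<xi> ^ 2) (at \<xi>)"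
      by (rule has_field_derivative_transform_within_open[OF _ open_ball \<xi>]) (simp add: df)
  qed
  obtain r' where r': "r' > 0" "ball \<xi> r' \<subseteq> ball \<xi> r" "inj_on \<psi> (ball \<xi> r')"
    using has_complex_derivative_locally_injective[OF hol\<psi> \<xi> open_ball] d\<psi> gne[OF \<xi>] by metis
  have hol\<psi>': "\<psi> holomorphic_on ball \<xi> r'"
    using hol\<psi> r'(2) by (rule holomorphic_on_subset)
  obtain \<phi> where \<phi>: "\<phi> holomorphic_on \<psi> ` ball \<xi> r'"
    "\<And>z. z \<in> ball \<xi> r' \<Longrightarrow> deriv \<psi> z * deriv \<phi> (\<psi> z) = 1"
    "\<And>z. z \<in> ball \<xi> r' \<Longrightarrow> \<phi> (\<psi> z) = z"
    using holomorphic_has_inverse[OF hol\<psi>' open_ball r'(3)] by metis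
  have op: "open (\<psi> ` ball \<xi> r')"
    by (rule open_mapping_thm3[OF hol\<psi>' open_ball r'(3)])
  have \<psi>0: "\<psi> \<xi> = 0" "0 \<in> \<psi> ` ball \<xi> r'"
    using r' by (auto simp: \<psi>_def intro!: image_eqI[of _ _ \<xi>])
  have \<phi>0: "\<phi> 0 = \<xi>" "deriv \<phi> 0 = inverse (g \<xi>)"
    using \<phi>(2,3)[of \<xi>] r' \<psi>0 d\<psi> by (auto simp: inverse_unique)
  define Z where "Z s = \<phi> (\<i> * of_real s * g \<xi>)" for s :: real
  have lim0: "((\<lambda>s. \<i> * of_real s * g \<xi>) \<longlongrightarrow> 0) (at_right 0)"
    by (auto intro!: tendsto_eq_intros)
  have "\<forall>\<^sub>F s in at_right 0. f (Z s) = f \<xi> - deriv (deriv f) \<xi> / 2 * of_real s ^ 2"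
    using topological_tendstoD[OF lim0 op \<psi>0(2)]
  proof eventually_elim
    case (elim s)
    then obtain z where z: "z \<in> ball \<xi> r'" "\<psi> z = \<i> * of_real s * g \<xi>"
      by auto
    then have "Z s = z"
      using \<phi>(3) by (metis Z_def)
    moreover have "f z - f \<xi> = \<psi> z ^ 2"
      using feq[of z] z(1) r'(2) by (auto simp: \<psi>_def)
    ultimately show ?case
      by (simp add: z(2) ddf power_mult_distrib algebra_simps)
  qed
  moreover have "((\<lambda>s. (Z s - \<xi>) / of_real s) \<longlongrightarrow> \<i>) (at_right 0)"
  proof -
    have "(\<phi> has_field_derivative inverse (g \<xi>)) (at 0)"
      using holomorphic_derivI[OF \<phi>(1) op \<psi>0(2)] \<phi>0(2) by simp
    then have d\<phi>: "((\<lambda>h. (\<phi> h - \<xi>) / h) \<longlongrightarrow> inverse (g \<xi>)) (at 0)"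
      by (simp add: DERIV_def \<phi>0)
    have "\<forall>\<^sub>F s in at_right 0. \<i> * of_real s * g \<xi> \<noteq> 0"
      using gne[OF \<xi>] by (intro eventually_at_right_less[THEN eventually_mono]) auto
    then have "filterlim (\<lambda>s. \<i> * of_real s * g \<xi>) (at 0) (at_right 0)"
      using lim0 by (simp add: filterlim_at)
    from tendsto_mult[OF filterlim_compose[OF d\<phi> this] tendsto_const[of "\<i> * g \<xi>"]]
    have "((\<lambda>s. (Z s - \<xi>) / (\<i> * of_real s * g \<xi>) * (\<i> * g \<xi>)) \<longlongrightarrow> \<i>) (at_right 0)"
      using gne[OF \<xi>] by (simp add: Z_def field_simps)
    moreover have "(Z s - \<xi>) / (\<i> * of_real s * g \<xi>) * (\<i> * g \<xi>) = (Z s - \<xi>) / of_real s" for s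
      using gne[OF \<xi>] by simp
    ultimately show ?thesis
      by simp
  qed
  ultimately show ?thesis
    by (rule that)
qed

lemma potential_has_field_derivative:
  assumes "Im z > 0"
  shows "(potential I e k has_field_derivative efield I e k z) (at z)"
  unfolding potential_def efield_def divide_inverse
  using assms by (intro DERIV_sum) (auto intro!: derivative_eq_intros simp: complex_nonpos_Reals_iff divide_inverse)

lemma efield_has_field_derivative:
  fixes z :: "'a::real_normed_field"
  assumes "\<And>i. i \<in> I \<Longrightarrow> z \<noteq> of_real (k i)"
  shows "(efield I e k has_field_derivative - (\<Sum>i\<in>I. of_real (e i) / (z - of_real (k i))\<^sup>2)) (at z)"
  unfolding efield_def sum_negf[symmetric]
  using assms by (intro DERIV_sum) (auto intro!: derivative_eq_intros simp: power2_eq_square)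

context separated_charges
begin

text \<open>The map \<open>w \<mapsto> a + exp w\<close> sends the strip \<open>0 < Im w < pi\<close> onto the upper half-plane and turns the derivative
  of the potential into \<open>(z - a)\<close> times the field, which has positive imaginary part. On a convex set this forces
  injectivity (Noshiro and Warschawski): along the segment from \<open>w1\<close> to \<open>w2\<close> the imaginary part of
  the potential divided by \<open>w2 - w1\<close> is strictly increasing.\<close>

lemma inj_on_potential: "inj_on (potential I e k) {z. Im z > 0}"
proof (rule inj_onI)
  fix z1 z2 assume z: "z1 \<in> {z. Im z > 0}" "z2 \<in> {z. Im z > 0}"
    and eq: "potential I e k z1 = potential I e k z2"
  define w1 w2 where "w1 = Ln (z1 - of_real a)" and "w2 = Ln (z2 - of_real a)"
  have Im_w: "Im w1 \<in> {0<..<pi}" "Im w2 \<in> {0<..<pi}"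
    using z Im_Ln_pos_lt[of "z1 - of_real a"] Im_Ln_pos_lt[of "z2 - of_real a"]
    by (auto simp: w1_def w2_def complex_eq_iff)
  have exp_w: "of_real a + exp w1 = z1" "of_real a + exp w2 = z2"
    using z by (auto simp: w1_def w2_def complex_eq_iff[of _ 0] exp_Ln)
  define w where "w s = w1 + s *\<^sub>R (w2 - w1)" for s :: real
  define Z where "Z s = of_real a + exp (w s)" for s
  have Z01: "Z 0 = z1" "Z 1 = z2"
    by (auto simp: Z_def w_def exp_w)
  have Im_Z: "Im (Z s) > 0" if "0 \<le> s" "s \<le> 1" for s
  proof -
    have "Im (w s) = (1 - s) * Im w1 + s * Im w2"
      by (simp add: w_def algebra_simps)
    moreover have "\<dots> \<in> {0<..<pi}"
      using convexD[OF convex_real_interval(8) Im_w, of "1 - s" s] that by auto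
    ultimately have "sin (Im (w s)) > 0"
      by (intro sin_gt_zero) auto
    then show ?thesis
      by (simp add: Z_def Im_exp)
  qed
  show "z1 = z2"
  proof (rule ccontr)
    assume "z1 \<noteq> z2"
    then have ne: "w2 - w1 \<noteq> 0"
      using exp_w by auto
    define \<phi> where "\<phi> s = Im (potential I e k (Z s) / (w2 - w1))" for s
    have "\<exists>y. (\<phi> has_real_derivative y) (at s) \<and> y > 0" if s: "0 \<le> s" "s \<le> 1" for s
    proof (intro exI conjI)
      have "(w has_vector_derivative (w2 - w1)) (at s)"
        unfolding w_def by (auto intro!: derivative_eq_intros)
      moreover have "((\<lambda>w. of_real a + exp w) has_field_derivative exp (w s)) (at (w s))"
        by (auto intro!: derivative_eq_intros)
      ultimately have "(Z has_vector_derivative (w2 - w1) * exp (w s)) (at s)"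
        unfolding Z_def by (rule field_vector_diff_chain_at[unfolded o_def])
      moreover have "((\<lambda>z. potential I e k z / (w2 - w1)) has_field_derivative efield I e k (Z s) / (w2 - w1)) (at (Z s))"
        by (intro DERIV_cdivide potential_has_field_derivative Im_Z s)
      ultimately have "((\<lambda>s. potential I e k (Z s) / (w2 - w1)) has_vector_derivative
          (w2 - w1) * exp (w s) * (efield I e k (Z s) / (w2 - w1))) (at s)"
        by (rule field_vector_diff_chain_at[unfolded o_def])
      also have "(w2 - w1) * exp (w s) * (efield I e k (Z s) / (w2 - w1)) = (Z s - of_real a) * efield I e k (Z s)"
        using ne by (simp add: Z_def)
      finally show "(\<phi> has_real_derivative Im ((Z s - of_real a) * efield I e k (Z s))) (at s)"
        unfolding \<phi>_def has_real_derivative_iff_has_vector_derivative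
        by (rule bounded_linear.has_vector_derivative[OF bounded_linear_Im])
      show "Im ((Z s - of_real a) * efield I e k (Z s)) > 0"
        by (intro weighted_efield_Im_pos Im_Z s)
    qed
    then have "\<phi> 0 < \<phi> 1"
      by (rule DERIV_pos_imp_increasing[OF zero_less_one])
    then show False
      using eq by (simp add: \<phi>_def Z01)
  qed
qed

text \<open>The assumption on \<open>\<eta>\<close> says that \<open>\<eta> t\<close> has the sign opposite to that of the second derivative \<open>c\<close> at \<open>\<rho>\<close>.
  The level curve through \<open>\<rho>\<close> on which the potential differs from its value at \<open>\<rho>\<close> by real numbers of that sign
  leaves \<open>\<rho>\<close> vertically, and by univalence its points in the upper half-plane are the preimages in question.\<close>

lemma Arg_potential_preimage_near_critical_point:
  assumes crit: "efield I e k \<rho> = 0" and \<rho>: "\<And>i. i \<in> I \<Longrightarrow> \<rho> \<noteq> k i"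
    and \<eta>: "(\<eta> \<longlongrightarrow> 0) F" "\<forall>\<^sub>F t in F. (\<rho> - a) * \<eta> t < 0"
  shows "((\<lambda>t. Arg (inv_into {z. Im z > 0} (potential I e k)
                      (potential I e k (of_real \<rho>) + of_real (\<eta> t)) - of_real \<rho>)) \<longlongrightarrow> pi / 2) F"
proof -
  \<comment> \<open>The principal logarithm jumps along the real line to the left of each site. Replacing it by
      \<open>Ln (k - z) + \<i> pi\<close> for the sites to the right of \<open>\<rho>\<close> gives the function \<open>H\<close>, which is holomorphic
      on a neighbourhood \<open>S\<close> of \<open>\<rho>\<close> and agrees with the potential in the closed upper half-plane.\<close>
  define S where "S = (\<Inter>i\<in>I. if k i < \<rho> then {z. Re z > k i} else {z. Re z < k i})"
  define H where "H z = (\<Sum>i\<in>I. of_real (e i) *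
      (if k i < \<rho> then Ln (z - of_real (k i)) else Ln (of_real (k i) - z) + \<i> * of_real pi))" for z
  define c where "c = - (\<Sum>i\<in>I. e i / (\<rho> - k i)\<^sup>2)"
  have "open S"
    unfolding S_def using finite_I
    by (rule open_INT) (simp add: open_halfspace_Re_gt open_halfspace_Re_lt)
  moreover have "of_real \<rho> \<in> S"
    unfolding S_def using \<rho> by (auto simp: not_less less_le)
  ultimately have S: "open S" "of_real \<rho> \<in> S" .
  have H_deriv: "(H has_field_derivative efield I e k z) (at z)" if "z \<in> S" for z
    unfolding H_def efield_def
  proof (intro DERIV_sum)
    fix i assume "i \<in> I"
    with that have *: "if k i < \<rho> then Re z > k i else Re z < k i"
      unfolding S_def by (auto split: if_splits)
    show "((\<lambda>z. of_real (e i) * (if k i < \<rho> then Ln (z - of_real (k i)) else Ln (of_real (k i) - z) + \<i> * of_real pi))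
            has_field_derivative of_real (e i) / (z - of_real (k i))) (at z)"
    proof (cases "k i < \<rho>")
      case True
      with * have "z - of_real (k i) \<notin> \<real>\<^sub>\<le>\<^sub>0"
        by (auto simp: complex_nonpos_Reals_iff)
      with True show ?thesis
        by (auto intro!: derivative_eq_intros simp: divide_inverse)
    next
      case False
      with * have "of_real (k i) - z \<notin> \<real>\<^sub>\<le>\<^sub>0"
        by (auto simp: complex_nonpos_Reals_iff)
      moreover from False * have "z \<noteq> of_real (k i)"
        by auto
      ultimately show ?thesis
        using False by (auto intro!: derivative_eq_intros simp: divide_simps) (simp add: algebra_simps)
    qed
  qed
  then have H_hol: "H holomorphic_on S"
    using S(1) holomorphic_on_open by blast
  have H_eq: "H z = potential I e k z" if "z \<in> S" "Im z \<ge> 0" for z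
    unfolding H_def potential_def
  proof (intro sum.cong refl)
    fix i assume "i \<in> I"
    with that have *: "if k i < \<rho> then Re z > k i else Re z < k i"
      unfolding S_def by (auto split: if_splits)
    show "of_real (e i) * (if k i < \<rho> then Ln (z - of_real (k i)) else Ln (of_real (k i) - z) + \<i> * of_real pi) =
          of_real (e i) * Ln (z - of_real (k i))"
    proof (cases "k i < \<rho>")
      case False
      then have "of_real (k i) - z \<noteq> 0"
        using * by auto
      with False * that(2) Ln_minus[of "of_real (k i) - z"] show ?thesis
        by auto
    qed auto
  qed
  have dH: "deriv H z = efield I e k z" if "z \<in> S" for z
    by (rule DERIV_imp_deriv[OF H_deriv[OF that]])
  have ddH: "deriv (deriv H) (of_real \<rho>) = of_real c"
  proof (rule DERIV_imp_deriv)
    have "of_real \<rho> \<noteq> (of_real (k i) :: complex)" if "i \<in> I" for i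
      using \<rho>[OF that] by simp
    then have "(efield I e k has_field_derivative of_real c) (at (of_real \<rho> :: complex))"
      using efield_has_field_derivative[of I "of_real \<rho> :: complex" k e] by (simp add: c_def)
    then show "(deriv H has_field_derivative of_real c) (at (of_real \<rho>))"
      by (rule has_field_derivative_transform_within_open[OF _ S]) (simp add: dH)
  qed
  have c: "(\<rho> - a) * c > 0"
    using efield_zero_slope[OF crit \<rho>] by (simp add: c_def)
  then have "c \<noteq> 0"
    by auto
  obtain Z where Z: "\<forall>\<^sub>F s in at_right 0. H (Z s) = H (of_real \<rho>) - of_real c / 2 * of_real s ^ 2"
    "((\<lambda>s. (Z s - of_real \<rho>) / of_real s) \<longlongrightarrow> \<i>) (at_right 0)"
    using simple_critical_point_preimage[OF H_hol S] ddH dH[OF S(2)] \<open>c \<noteq> 0\<close> crit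
    by (auto simp: efield_of_real)
  \<comment> \<open>The parameter of the vertical curve for which minus \<open>c / 2\<close> times the square of the parameter is \<open>\<eta> t\<close>.\<close>
  define s where "s t = sqrt (- 2 * \<eta> t / c)" for t
  have s_pos: "\<forall>\<^sub>F t in F. s t > 0 \<and> \<eta> t = - (c / 2 * s t ^ 2)"
    using \<eta>(2)
  proof eventually_elim
    case (elim t)
    then have "\<eta> t / c < 0"
      using c by (auto simp: zero_less_mult_iff mult_less_0_iff divide_less_0_iff)
    then have "- 2 * \<eta> t / c > 0"
      by simp
    then show ?case
      using \<open>c \<noteq> 0\<close> by (simp add: s_def)
  qed
  have "(s \<longlongrightarrow> 0) F"
    unfolding s_def using \<open>c \<noteq> 0\<close> \<eta>(1) by (auto intro!: tendsto_eq_intros)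
  then have s_lim: "filterlim s (at_right 0) F"
    using s_pos by (intro tendsto_imp_filterlim_at_right) (auto elim: eventually_mono)
  have quot: "((\<lambda>t. (Z (s t) - of_real \<rho>) / of_real (s t)) \<longlongrightarrow> \<i>) F"
    by (rule filterlim_compose[OF Z(2) s_lim])
  have "((\<lambda>t. (Z (s t) - of_real \<rho>) / of_real (s t) * of_real (s t) + of_real \<rho>) \<longlongrightarrow> \<i> * of_real 0 + of_real \<rho>) F"
    by (intro tendsto_intros quot \<open>(s \<longlongrightarrow> 0) F\<close>)
  moreover have "\<forall>\<^sub>F t in F. (Z (s t) - of_real \<rho>) / of_real (s t) * of_real (s t) + of_real \<rho> = Z (s t)"
    using s_pos by eventually_elim simp
  ultimately have "((\<lambda>t. Z (s t)) \<longlongrightarrow> \<i> * of_real 0 + of_real \<rho>) F"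
    by (rule Lim_transform_eventually)
  then have Z_S: "\<forall>\<^sub>F t in F. Z (s t) \<in> S"
    using S by (intro topological_tendstoD) auto
  have Im_quot: "\<forall>\<^sub>F t in F. Im ((Z (s t) - of_real \<rho>) / of_real (s t)) > 0"
    using tendsto_Im[OF quot] by (rule order_tendstoD) simp
  have Arg_lim: "((\<lambda>t. Arg ((Z (s t) - of_real \<rho>) / of_real (s t))) \<longlongrightarrow> pi / 2) F"
    using tendsto_Arg[OF quot] by (simp add: complex_nonpos_Reals_iff)
  show ?thesis
  proof (rule Lim_transform_eventually[OF Arg_lim])
    show "\<forall>\<^sub>F t in F. Arg ((Z (s t) - of_real \<rho>) / of_real (s t)) =
            Arg (inv_into {z. Im z > 0} (potential I e k)
                      (potential I e k (of_real \<rho>) + of_real (\<eta> t)) - of_real \<rho>)"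
      using s_pos Z_S Im_quot filterlim_iff[THEN iffD1, OF s_lim, rule_format, OF Z(1)]
    proof eventually_elim
      case (elim t)
      then have Im_Z: "Im (Z (s t)) > 0"
        by (simp add: Im_divide_of_real zero_less_divide_iff)
      have "potential I e k (Z (s t)) = H (of_real \<rho>) - of_real c / 2 * of_real (s t) ^ 2"
        using H_eq[of "Z (s t)"] elim Im_Z by simp
      also have "\<dots> = potential I e k (of_real \<rho>) + of_real (\<eta> t)"
        using H_eq[OF S(2)] elim(1) by simp
      finally have "inv_into {z. Im z > 0} (potential I e k) (potential I e k (of_real \<rho>) + of_real (\<eta> t)) = Z (s t)"
        using Im_Z by (intro inv_into_f_eq[OF inj_on_potential]) auto
      then show ?case
        using elim(1) by simp
    qed
  qed
qed

end

section \<open>Charges collapsing to a point\<close>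

text \<open>All sites move exponentially towards \<open>K\<close>, or rest if \<open>\<theta> i = 0\<close>. The sign condition is weak because one
  charge sits at \<open>K\<close> itself.\<close>

locale collapsing_charges =
  fixes I :: "'i set" and e \<kappa> \<theta> :: "'i \<Rightarrow> real" and K :: real
  assumes finite_I: "finite I"
    and sign: "\<And>i. i \<in> I \<Longrightarrow> e i * (\<kappa> i - K) \<le> 0"
    and \<theta>_nonneg: "\<And>i. i \<in> I \<Longrightarrow> \<theta> i \<ge> 0"
begin

definition site :: "real \<Rightarrow> 'i \<Rightarrow> real" where
  "site t i = K + (\<kappa> i - K) * exp (- \<theta> i * t)"

text \<open>The real part of the potential on the real line.\<close>

definition height :: "real \<Rightarrow> real \<Rightarrow> real" where
  "height t x = (\<Sum>i\<in>I. e i * ln \<bar>x - site t i\<bar>)"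

text \<open>The derivative of the height with respect to \<open>t\<close> at a fixed point \<open>x\<close>.\<close>

definition drift :: "real \<Rightarrow> real \<Rightarrow> real" where
  "drift t x = (\<Sum>i\<in>I. e i * \<theta> i * (site t i - K) / (x - site t i))"

lemma sign_site: "i \<in> I \<Longrightarrow> e i * (site t i - K) \<le> 0"
  using sign[of i] mult_nonpos_nonneg[of "e i * (\<kappa> i - K)" "exp (- \<theta> i * t)"]
  by (simp add: site_def mult.assoc)

text \<open>In the coordinates \<open>t\<close> and \<open>ln \<bar>x - K\<bar>\<close> the height is concave for \<open>x < K\<close> and convex for \<open>x > K\<close>; the factor
  \<open>x - K\<close> merges the two cases. The lemma compares the height with its tangent plane at a critical point, where the
  slope in the direction \<open>ln \<bar>x - K\<bar>\<close> vanishes and only the drift remains.\<close>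

lemma height_tangent:
  assumes side: "(x - K) * (x' - K) > 0"
    and order: "\<And>i. i \<in> I \<Longrightarrow> (x - site t i) * (x' - site t' i) > 0"
    and crit: "efield I e (site t) x = 0"
  shows "(x - K) * (height t' x' - height t x - drift t x * (t' - t)) \<ge> 0"
proof -
  define L where "L = ln ((x' - K) / (x - K))"
  \<comment> \<open>The gap between the term of site \<open>i\<close> and its tangent plane.\<close>
  define D where "D i = ln \<bar>x' - site t' i\<bar> - ln \<bar>x - site t i\<bar>
      - ((x - K) * L + (site t i - K) * \<theta> i * (t' - t)) / (x - site t i)" for i
  have D: "e i * ((x - K) * D i) \<ge> 0" if i: "i \<in> I" for i
  proof -
    have exp: "(site t i - K) * exp (- \<theta> i * (t' - t)) = site t' i - K"
      by (simp add: site_def mult.assoc flip: exp_add) (simp add: algebra_simps)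
    have Deq: "D i = ln \<bar>(x' - K) - (site t i - K) * exp (- \<theta> i * (t' - t))\<bar> - ln \<bar>(x - K) - (site t i - K)\<bar>
        - ((x - K) * ln ((x' - K) / (x - K)) - (site t i - K) * (- \<theta> i * (t' - t))) / ((x - K) - (site t i - K))"
      unfolding exp by (simp add: D_def L_def algebra_simps)
    have "((x - K) - (site t i - K)) * ((x' - K) - (site t i - K) * exp (- \<theta> i * (t' - t))) > 0"
      unfolding exp using order[OF i] by simp
    note tangent = ln_abs_diff_tangent[OF side this, folded Deq]
    show ?thesis
    proof (cases "site t i = K")
      case True
      then show ?thesis
        using tangent(2) by simp
    next
      case False
      have "0 \<le> (e i * (site t i - K)) * ((site t i - K) * (x - K) * D i)"
        using sign_site[OF i, of t] tangent(1) by (rule mult_nonpos_nonpos)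
      also have "\<dots> = (site t i - K)\<^sup>2 * (e i * ((x - K) * D i))"
        by (simp add: power2_eq_square)
      finally show ?thesis
        using False by (simp add: zero_le_mult_iff)
    qed
  qed
  have "(\<Sum>i\<in>I. e i * ((x - K) * D i)) = (x - K) * (\<Sum>i\<in>I. e i * D i)"
    by (simp add: sum_distrib_left algebra_simps)
  also have "(\<Sum>i\<in>I. e i * D i) = height t' x' - height t x - (x - K) * L * efield I e (site t) x - drift t x * (t' - t)"
    unfolding height_def drift_def D_def efield_def sum_distrib_left sum_distrib_right sum_subtractf[symmetric]
    by (intro sum.cong refl) (simp add: add_divide_distrib diff_divide_distrib algebra_simps)
  finally show ?thesis
    using sum_nonneg[of I "\<lambda>i. e i * ((x - K) * D i)"] D crit by simp
qed

text \<open>At a critical point the drift would be \<open>- \<theta>0 * (\<Sum>i\<in>I. e i)\<close> if all exponents were equal to \<open>\<theta>0\<close>. Subtracting this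
  value leaves the exponents \<open>\<theta> i - \<theta>0\<close>. The monotonicity of the exponents on the side of \<open>x\<close> makes the
  terms of that side favourable, and the terms of the other side are bounded because there the fraction
  \<open>(site t i - K) / (x - site t i)\<close> is less than \<open>1\<close> in absolute value. For \<open>\<theta>0 = 0\<close> the drift has a definite
  sign.\<close>

lemma drift_bound:
  assumes crit: "efield I e (site t) x = 0" and "x \<noteq> K" and "\<theta>0 \<ge> 0"
    and nz: "\<And>i. i \<in> I \<Longrightarrow> x \<noteq> site t i"
    and outer: "\<And>i. i \<in> I \<Longrightarrow> (site t i - K) * (x - K) > 0 \<Longrightarrow> \<bar>x - K\<bar> < \<bar>site t i - K\<bar> \<Longrightarrow> \<theta> i \<le> \<theta>0"
    and inner: "\<And>i. i \<in> I \<Longrightarrow> (site t i - K) * (x - K) > 0 \<Longrightarrow> \<bar>site t i - K\<bar> < \<bar>x - K\<bar> \<Longrightarrow> \<theta>0 \<le> \<theta> i"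
  shows "sgn (x - K) * drift t x \<le> 2 * \<theta>0 * (\<Sum>i\<in>I. \<bar>e i\<bar>)"
proof -
  define \<sigma> where "\<sigma> i = site t i - K" for i
  define v where "v = x - K"
  have bound: "sgn v * (e i * (\<theta> i - \<theta>0) * \<sigma> i / (v - \<sigma> i)) \<le> \<theta>0 * \<bar>e i\<bar>" if i: "i \<in> I" for i
  proof -
    have sg: "e i * \<sigma> i \<le> 0"
      using sign_site[OF i] by (simp add: \<sigma>_def)
    have ne: "v \<noteq> \<sigma> i" "v \<noteq> 0"
      using nz[OF i] assms(2) by (auto simp: v_def \<sigma>_def)
    have q: "sgn v * (e i * (\<theta> i - \<theta>0) * \<sigma> i / (v - \<sigma> i))
        = (e i * \<sigma> i) * ((\<theta> i - \<theta>0) * (sgn v / (v - \<sigma> i)))"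
      by simp
    consider "\<sigma> i = 0" | "\<sigma> i * v < 0" | "\<sigma> i * v > 0"
      using ne by (cases "\<sigma> i * v" "0 :: real" rule: linorder_cases) auto
    then show ?thesis
    proof cases
      case 1
      then show ?thesis
        using assms(3) by simp
    next
      case 2
      have le1: "\<bar>\<sigma> i\<bar> * (sgn v / (v - \<sigma> i)) \<le> 1" "sgn v / (v - \<sigma> i) \<ge> 0"
        using 2 ne by (auto simp: mult_less_0_iff sgn_if divide_le_eq le_divide_eq divide_simps split: if_splits)
      have "\<theta>0 - \<theta> i \<le> \<theta>0"
        using \<theta>_nonneg[OF i] by simp
      have "(e i * \<sigma> i) * ((\<theta> i - \<theta>0) * (sgn v / (v - \<sigma> i)))
          = (\<theta>0 - \<theta> i) * (\<bar>e i\<bar> * (\<bar>\<sigma> i\<bar> * (sgn v / (v - \<sigma> i))))"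
      proof -
        have "e i * \<sigma> i = - (\<bar>e i\<bar> * \<bar>\<sigma> i\<bar>)"
          using sg by (simp flip: abs_mult)
        then show ?thesis
          by (simp only:) (simp add: algebra_simps)
      qed
      also have "\<dots> \<le> \<theta>0 * (\<bar>e i\<bar> * (\<bar>\<sigma> i\<bar> * (sgn v / (v - \<sigma> i))))"
        using \<open>\<theta>0 - \<theta> i \<le> \<theta>0\<close> le1(2) by (intro mult_right_mono mult_nonneg_nonneg) auto
      also have "\<dots> \<le> \<theta>0 * (\<bar>e i\<bar> * 1)"
        using le1(1) assms(3) by (intro mult_left_mono) auto
      finally show ?thesis
        by (simp only: q)
    next
      case 3
      have "(\<theta> i - \<theta>0) * (sgn v / (v - \<sigma> i)) \<ge> 0"
      proof (cases "\<bar>v\<bar> < \<bar>\<sigma> i\<bar>")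
        case True
        then have "\<theta> i - \<theta>0 \<le> 0"
          using outer[OF i] 3 by (simp add: \<sigma>_def v_def)
        moreover have "sgn v / (v - \<sigma> i) \<le> 0"
          using True 3 by (auto simp: sgn_if zero_less_mult_iff divide_le_0_iff)
        ultimately show ?thesis
          by (rule mult_nonpos_nonpos)
      next
        case False
        with ne 3 have less: "\<bar>\<sigma> i\<bar> < \<bar>v\<bar>"
          by (auto simp: zero_less_mult_iff abs_if split: if_splits)
        then have "\<theta> i - \<theta>0 \<ge> 0"
          using inner[OF i] 3 by (simp add: \<sigma>_def v_def)
        moreover have "sgn v / (v - \<sigma> i) \<ge> 0"
          using less 3 by (auto simp: sgn_if zero_less_mult_iff zero_le_divide_iff)
        ultimately show ?thesis
          by (rule mult_nonneg_nonneg)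
      qed
      then have "(e i * \<sigma> i) * ((\<theta> i - \<theta>0) * (sgn v / (v - \<sigma> i))) \<le> 0"
        using sg by (rule mult_nonpos_nonneg[rotated])
      also have "\<dots> \<le> \<theta>0 * \<bar>e i\<bar>"
        using assms(3) by simp
      finally show ?thesis
        by (simp only: q)
    qed
  qed
  have "(\<Sum>i\<in>I. e i * \<sigma> i / (v - \<sigma> i)) = (\<Sum>i\<in>I. v * (e i / (x - site t i)) - e i)"
  proof (intro sum.cong refl)
    fix i assume "i \<in> I"
    then show "e i * \<sigma> i / (v - \<sigma> i) = v * (e i / (x - site t i)) - e i"
      using nz[of i] by (simp add: v_def \<sigma>_def field_simps)
  qed
  also have "\<dots> = v * efield I e (site t) x - (\<Sum>i\<in>I. e i)"
    by (simp add: sum_subtractf efield_def sum_distrib_left)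
  also have "\<dots> = - (\<Sum>i\<in>I. e i)"
    using crit by simp
  finally have moment: "(\<Sum>i\<in>I. e i * \<sigma> i / (v - \<sigma> i)) = - (\<Sum>i\<in>I. e i)" .
  have "drift t x = (\<Sum>i\<in>I. e i * (\<theta> i - \<theta>0) * \<sigma> i / (v - \<sigma> i) + \<theta>0 * (e i * \<sigma> i / (v - \<sigma> i)))"
    unfolding drift_def
  proof (intro sum.cong refl)
    fix i
    have "x - site t i = v - \<sigma> i" "site t i - K = \<sigma> i"
      by (simp_all add: v_def \<sigma>_def)
    then show "e i * \<theta> i * (site t i - K) / (x - site t i)
        = e i * (\<theta> i - \<theta>0) * \<sigma> i / (v - \<sigma> i) + \<theta>0 * (e i * \<sigma> i / (v - \<sigma> i))"
      by (simp only:) (simp add: divide_inverse algebra_simps)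
  qed
  also have "\<dots> = (\<Sum>i\<in>I. e i * (\<theta> i - \<theta>0) * \<sigma> i / (v - \<sigma> i)) - \<theta>0 * (\<Sum>i\<in>I. e i)"
    unfolding sum.distrib sum_distrib_left[symmetric] moment by simp
  finally have drift: "drift t x = (\<Sum>i\<in>I. e i * (\<theta> i - \<theta>0) * \<sigma> i / (v - \<sigma> i)) - \<theta>0 * (\<Sum>i\<in>I. e i)" .
  have "sgn v * drift t x = (\<Sum>i\<in>I. sgn v * (e i * (\<theta> i - \<theta>0) * \<sigma> i / (v - \<sigma> i))) - sgn v * \<theta>0 * (\<Sum>i\<in>I. e i)"
    unfolding drift sum_distrib_left[symmetric] by (simp only: right_diff_distrib mult.assoc)
  also have "\<dots> \<le> (\<Sum>i\<in>I. \<theta>0 * \<bar>e i\<bar>) + \<theta>0 * (\<Sum>i\<in>I. \<bar>e i\<bar>)"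
  proof -
    have "- sgn v * (\<Sum>i\<in>I. e i) \<le> \<bar>\<Sum>i\<in>I. e i\<bar>"
      by (auto simp: sgn_if)
    also have "\<dots> \<le> (\<Sum>i\<in>I. \<bar>e i\<bar>)"
      by (rule sum_abs)
    finally have "\<theta>0 * (- sgn v * (\<Sum>i\<in>I. e i)) \<le> \<theta>0 * (\<Sum>i\<in>I. \<bar>e i\<bar>)"
      using assms(3) by (rule mult_left_mono)
    then have "- (sgn v * \<theta>0 * (\<Sum>i\<in>I. e i)) \<le> \<theta>0 * (\<Sum>i\<in>I. \<bar>e i\<bar>)"
      by (simp add: mult_ac)
    moreover have "(\<Sum>i\<in>I. sgn v * (e i * (\<theta> i - \<theta>0) * \<sigma> i / (v - \<sigma> i))) \<le> (\<Sum>i\<in>I. \<theta>0 * \<bar>e i\<bar>)"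
      by (intro sum_mono bound)
    ultimately show ?thesis
      by linarith
  qed
  finally show ?thesis
    by (simp add: v_def algebra_simps sum_distrib_left)
qed

text \<open>Here \<open>\<delta>\<close> is the side of \<open>K\<close> on which the critical point lies and \<open>\<tau>\<close> records its position among the sites. By
  \<open>height_tangent\<close>, minus the drift is a supergradient of minus the critical height in the case
  \<open>\<delta> = 1\<close>, and the drift one of the critical height in the case \<open>\<delta> = - 1\<close>; \<open>drift_bound\<close>
  keeps these supergradients bounded below.\<close>

lemma critical_height_slope:
  fixes \<rho> :: "real \<Rightarrow> real"
  assumes crit: "\<And>t. t \<ge> 0 \<Longrightarrow> efield I e (site t) (\<rho> t) = 0"
    and side: "\<And>t. t \<ge> 0 \<Longrightarrow> sgn (\<rho> t - K) = \<delta>" "\<delta> \<noteq> 0"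
    and order: "\<And>t i. t \<ge> 0 \<Longrightarrow> i \<in> I \<Longrightarrow> sgn (\<rho> t - site t i) = \<tau> i" "\<And>i. i \<in> I \<Longrightarrow> \<tau> i \<noteq> 0"
    and "\<theta>0 \<ge> 0"
    and inner: "\<And>i. i \<in> I \<Longrightarrow> (\<kappa> i - K) * \<delta> > 0 \<Longrightarrow> \<tau> i = \<delta> \<Longrightarrow> \<theta>0 \<le> \<theta> i"
    and outer: "\<And>i. i \<in> I \<Longrightarrow> (\<kappa> i - K) * \<delta> > 0 \<Longrightarrow> \<tau> i = - \<delta> \<Longrightarrow> \<theta> i \<le> \<theta>0"
  obtains L where "((\<lambda>t. height t (\<rho> t) / t) \<longlongrightarrow> L) at_top"
    and "\<And>t. t \<ge> 0 \<Longrightarrow> \<delta> * (height t (\<rho> t) - height 0 (\<rho> 0)) \<le> \<delta> * L * t"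
    and "\<delta> * L \<le> 2 * \<theta>0 * (\<Sum>i\<in>I. \<bar>e i\<bar>)"
    and "((\<lambda>t. height t (\<rho> t)) \<longlongrightarrow> height 0 (\<rho> 0)) (at_right 0)"
proof -
  have \<delta>: "\<delta> = 1 \<or> \<delta> = -1"
    using side(1)[of 0] side(2) by (auto simp: sgn_if split: if_splits)
  then have \<delta>2: "\<delta> * \<delta> = 1" "\<And>x. \<delta> * (\<delta> * x) = x"
    by auto
  define u where "u t = - \<delta> * height t (\<rho> t)" for t
  define s where "s t = - \<delta> * drift t (\<rho> t)" for t
  have super: "u t' \<le> u t + s t * (t' - t)" if t: "t \<ge> 0" "t' \<ge> 0" for t t'
  proof -
    have "(\<rho> t - K) * (\<rho> t' - K) > 0"
      using side(1)[OF t(1)] side(1)[OF t(2)] side(2) by (auto simp: sgn_if zero_less_mult_iff split: if_splits)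
    moreover have "(\<rho> t - site t i) * (\<rho> t' - site t' i) > 0" if "i \<in> I" for i
      using order(1)[OF t(1) that] order(1)[OF t(2) that] order(2)[OF that]
      by (auto simp: sgn_if zero_less_mult_iff split: if_splits)
    ultimately have "(\<rho> t - K) * (height t' (\<rho> t') - height t (\<rho> t) - drift t (\<rho> t) * (t' - t)) \<ge> 0"
      using crit[OF t(1)] by (rule height_tangent)
    then have "\<delta> * (height t' (\<rho> t') - height t (\<rho> t) - drift t (\<rho> t) * (t' - t)) \<ge> 0"
      using side(1)[OF t(1)] side(2) unfolding zero_le_mult_iff by (auto simp: sgn_if split: if_splits)
    then show ?thesis
      by (simp add: u_def s_def algebra_simps)
  qed
  have lower: "s t \<ge> - (2 * \<theta>0 * (\<Sum>i\<in>I. \<bar>e i\<bar>))" if t: "t \<ge> 0" for t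
  proof -
    have same: "(\<kappa> i - K) * \<delta> > 0" if "(site t i - K) * (\<rho> t - K) > 0" for i
      using that side(1)[OF t] by (auto simp: site_def sgn_if zero_less_mult_iff mult_less_0_iff split: if_splits)
    have "sgn (\<rho> t - K) * drift t (\<rho> t) \<le> 2 * \<theta>0 * (\<Sum>i\<in>I. \<bar>e i\<bar>)"
    proof (rule drift_bound[OF crit[OF t]])
      show "\<rho> t \<noteq> K" "\<theta>0 \<ge> 0"
        using side(1)[OF t] side(2) assms(6) by auto
      show "\<rho> t \<noteq> site t i" if "i \<in> I" for i
        using order(1)[OF t that] order(2)[OF that] by auto
      fix i assume i: "i \<in> I" "(site t i - K) * (\<rho> t - K) > 0"
      show "\<theta> i \<le> \<theta>0" if "\<bar>\<rho> t - K\<bar> < \<bar>site t i - K\<bar>"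
      proof (rule outer[OF i(1) same[OF i(2)]])
        show "\<tau> i = - \<delta>"
          using i(2) that order(1)[OF t i(1)] side(1)[OF t]
          by (auto simp: sgn_if zero_less_mult_iff split: if_splits)
      qed
      show "\<theta>0 \<le> \<theta> i" if "\<bar>site t i - K\<bar> < \<bar>\<rho> t - K\<bar>"
      proof (rule inner[OF i(1) same[OF i(2)]])
        show "\<tau> i = \<delta>"
          using i(2) that order(1)[OF t i(1)] side(1)[OF t]
          by (auto simp: sgn_if zero_less_mult_iff split: if_splits)
      qed
    qed
    then show ?thesis
      using side(1)[OF t] by (simp add: s_def)
  qed
  obtain L where L: "((\<lambda>t. u t / t) \<longlongrightarrow> L) at_top" "\<forall>t\<ge>0. u t - u 0 \<ge> L * t"
    "L \<ge> - (2 * \<theta>0 * (\<Sum>i\<in>I. \<bar>e i\<bar>))" "(u \<longlongrightarrow> u 0) (at_right 0)"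
    using super lower by (rule supergradient_slope)
  have height_eq: "height t (\<rho> t) = - \<delta> * u t" for t
    by (simp add: u_def \<delta>2)
  show ?thesis
  proof (rule that[of "- \<delta> * L"])
    show "((\<lambda>t. height t (\<rho> t) / t) \<longlongrightarrow> - \<delta> * L) at_top"
      using tendsto_mult[OF tendsto_const[of "- \<delta>"] L(1)] by (simp add: height_eq)
    show "\<delta> * (height t (\<rho> t) - height 0 (\<rho> 0)) \<le> \<delta> * (- \<delta> * L) * t" if "t \<ge> 0" for t
      using L(2)[rule_format, OF that] by (simp add: height_eq right_diff_distrib \<delta>2)
    show "\<delta> * (- \<delta> * L) \<le> 2 * \<theta>0 * (\<Sum>i\<in>I. \<bar>e i\<bar>)"
      using L(3) by (simp add: \<delta>2)
    show "((\<lambda>t. height t (\<rho> t)) \<longlongrightarrow> height 0 (\<rho> 0)) (at_right 0)"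
      unfolding height_eq by (intro tendsto_intros L(4))
  qed
qed

text \<open>The imaginary part depends only on the order of \<open>x\<close> and the sites; hence it is constant along a critical point.\<close>

lemma potential_of_real:
  assumes "\<And>i. i \<in> I \<Longrightarrow> sgn (x - site t i) = \<tau> i" "\<And>i. i \<in> I \<Longrightarrow> \<tau> i \<noteq> 0"
  shows "potential I e (site t) (of_real x) =
           of_real (height t x) + \<i> * of_real pi * of_real (\<Sum>i\<in>I. if \<tau> i < 0 then e i else 0)"
proof -
  have "Ln (of_real x - of_real (site t i)) = of_real (ln \<bar>x - site t i\<bar>) + (if \<tau> i < 0 then \<i> * of_real pi else 0)"
    if "i \<in> I" for i
    using assms(1)[OF that] assms(2)[OF that] Ln_of_real'[of "x - site t i"]
    by (auto simp: sgn_if split: if_splits)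
  then show ?thesis
    unfolding potential_def height_def of_real_sum sum_distrib_left sum.distrib[symmetric]
    by (intro sum.cong refl) (auto simp: algebra_simps)
qed

lemma orthogonal_departure:
  fixes \<rho> :: "real \<Rightarrow> real"
  assumes sep: "separated_charges I e (site 0) a"
    and crit: "\<And>t. t \<ge> 0 \<Longrightarrow> efield I e (site t) (\<rho> t) = 0"
    and side: "sgn (\<rho> 0 - a) = \<delta>"
    and order: "\<And>t i. t \<ge> 0 \<Longrightarrow> i \<in> I \<Longrightarrow> sgn (\<rho> t - site t i) = \<tau> i" "\<And>i. i \<in> I \<Longrightarrow> \<tau> i \<noteq> 0"
    and slope: "\<And>t. t \<ge> 0 \<Longrightarrow> \<delta> * (height t (\<rho> t) - height 0 (\<rho> 0)) \<le> \<delta> * L * t"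
    and cont: "((\<lambda>t. height t (\<rho> t)) \<longlongrightarrow> height 0 (\<rho> 0)) (at_right 0)"
    and \<gamma>: "\<delta> * (L - \<gamma>) < 0"
  shows "((\<lambda>t. Arg (inv_into {z. Im z > 0} (potential I e (site 0))
             (potential I e (site t) (of_real (\<rho> t)) - of_real (\<gamma> * t)) - of_real (\<rho> 0))) \<longlongrightarrow> pi / 2) (at_right 0)"
proof -
  interpret separated_charges I e "site 0" a
    by (rule sep)
  define \<eta> where "\<eta> t = height t (\<rho> t) - height 0 (\<rho> 0) - \<gamma> * t" for t
  have "((\<lambda>t. Arg (inv_into {z. Im z > 0} (potential I e (site 0))
             (potential I e (site 0) (of_real (\<rho> 0)) + of_real (\<eta> t)) - of_real (\<rho> 0))) \<longlongrightarrow> pi / 2) (at_right 0)"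
  proof (rule Arg_potential_preimage_near_critical_point)
    show "efield I e (site 0) (\<rho> 0) = 0"
      by (simp add: crit)
    show "\<rho> 0 \<noteq> site 0 i" if "i \<in> I" for i
      using order(1)[of 0 i] order(2)[of i] that by auto
    show "(\<eta> \<longlongrightarrow> 0) (at_right 0)"
      unfolding \<eta>_def by (auto intro!: tendsto_eq_intros cont)
    show "\<forall>\<^sub>F t in at_right 0. (\<rho> 0 - a) * \<eta> t < 0"
    proof (rule eventually_at_right_less[THEN eventually_mono])
      fix t :: real assume t: "0 < t"
      have "\<delta> * \<eta> t \<le> \<delta> * (L - \<gamma>) * t"
        using slope[of t] t by (simp add: \<eta>_def algebra_simps)
      also have "\<dots> < 0"
        using \<gamma> t by (rule mult_neg_pos)
      finally show "(\<rho> 0 - a) * \<eta> t < 0"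
        using side by (auto simp: sgn_if mult_less_0_iff split: if_splits)
    qed
  qed
  moreover have "\<forall>\<^sub>F t in at_right 0. potential I e (site 0) (of_real (\<rho> 0)) + of_real (\<eta> t)
      = potential I e (site t) (of_real (\<rho> t)) - of_real (\<gamma> * t)"
  proof (rule eventually_at_right_less[THEN eventually_mono])
    fix t :: real assume t: "0 < t"
    show "potential I e (site 0) (of_real (\<rho> 0)) + of_real (\<eta> t)
        = potential I e (site t) (of_real (\<rho> t)) - of_real (\<gamma> * t)"
      using potential_of_real[of "\<rho> 0" 0 \<tau>] potential_of_real[of "\<rho> t" t \<tau>] order t
      by (simp add: \<eta>_def)
  qed
  ultimately show ?thesis
    by (elim Lim_transform_eventually) (auto elim: eventually_mono)
qed

end

section \<open>The flow of the critical points\<close>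

text \<open>Guarantees that derivatives within the closed upper half-plane are unique at real points.\<close>

lemma at_within_closed_upper_half_plane_neq_bot:
  "at (of_real x) within closed_upper_half_plane \<noteq> bot"
proof -
  have "of_real x islimpt closed_upper_half_plane"
    unfolding islimpt_approachable
  proof (intro allI impI)
    fix \<epsilon> :: real assume "\<epsilon> > 0"
    then show "\<exists>y\<in>closed_upper_half_plane. y \<noteq> of_real x \<and> dist y (of_real x) < \<epsilon>"
      by (intro bexI[of _ "of_real x + of_real (\<epsilon> / 2) * \<i>"])
        (auto simp: dist_norm norm_mult closed_upper_half_plane_def)
  qed
  then show ?thesis
    by (simp add: trivial_limit_within)
qed

text \<open>The ordering of the exponents keeps the moving sites in their initial order.\<close>

locale admissible_data =
  fixes P :: log_data
  assumes standing: "standing_assms P" and E0: "E0 P"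
begin

definition "idx = {1..np P} <+> {1..nm P}"

lemma Inl_in_idx [simp]: "Inl j \<in> idx \<longleftrightarrow> j \<in> {1..np P}"
  and Inr_in_idx [simp]: "Inr j \<in> idx \<longleftrightarrow> j \<in> {1..nm P}"
  by (auto simp: idx_def)

definition "charge = case_sum (bp P) (\<lambda>j. - bm P j)"

definition "start = case_sum (kp P) (km P)"

text \<open>The sites \<open>k\<^sub>1\<^sup>+\<close> and \<open>k\<^sub>N\<^sup>+\<close> are at rest, which is exponent \<open>0\<close>.\<close>

definition "speed = case_sum (\<lambda>j. if j = 1 \<or> j = np P then 0 else thetap P j) (thetam P)"

lemma np: "np P \<ge> 2" and nm: "nm P \<ge> 1"
  and bp_pos: "j \<in> {1..np P} \<Longrightarrow> bp P j > 0" and bm_pos: "j \<in> {1..nm P} \<Longrightarrow> bm P j > 0"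
  and kp_less: "i \<in> {1..np P} \<Longrightarrow> j \<in> {1..np P} \<Longrightarrow> i < j \<Longrightarrow> kp P i < kp P j"
  and km_less: "i \<in> {1..nm P} \<Longrightarrow> j \<in> {1..nm P} \<Longrightarrow> i < j \<Longrightarrow> km P i < km P j"
  and kp_km: "kp P (np P) < km P 1"
  and thetap_pos: "j \<in> {2..np P - 1} \<Longrightarrow> thetap P j > 0"
  and thetam_pos: "j \<in> {1..nm P} \<Longrightarrow> thetam P j > 0"
  and total: "bp_total P > bm_total P"
  using standing by (auto simp: standing_assms_def strict_mono_on_def)

lemma km_gt: "j \<in> {1..nm P} \<Longrightarrow> km P j > kp P (np P)"
  using kp_km km_less[of 1 j] nm by (cases "j = 1") auto

lemma speedp_mono:
  assumes "1 \<le> i" "i \<le> j" "j < np P"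
  shows "speed (Inl i) \<le> speed (Inl j)"
proof (cases "i = 1")
  case True
  then show ?thesis
    using assms thetap_pos[of j] by (cases "j = 1") (auto simp: speed_def less_imp_le)
next
  case False
  with assms have "i \<in> {2..np P - 1}" "j \<in> {2..np P - 1}"
    by auto
  then have "thetap P i \<le> thetap P j"
    using E0 assms(2) by (auto simp: E0_def mono_on_def)
  with False assms show ?thesis
    by (simp add: speed_def)
qed

lemma speedm_antimono:
  assumes "1 \<le> i" "i \<le> j" "j \<le> nm P"
  shows "speed (Inr j) \<le> speed (Inr i)"
  using assms E0 by (auto simp: speed_def E0_def monotone_on_def)

sublocale collapsing_charges idx charge start speed "kp P (np P)"
proof
  show "finite idx"
    by (simp add: idx_def)
  fix i assume i: "i \<in> idx"
  show "charge i * (start i - kp P (np P)) \<le> 0"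
  proof (cases i)
    case (Inl j)
    with i kp_less[of j "np P"] have "kp P j \<le> kp P (np P)"
      by (cases "j = np P") (auto simp: idx_def)
    with i Inl bp_pos[of j] show ?thesis
      by (auto simp: charge_def start_def idx_def mult_le_0_iff)
  next
    case (Inr j)
    with i km_gt[of j] bm_pos[of j] show ?thesis
      by (auto simp: charge_def start_def idx_def mult_le_0_iff)
  qed
  show "speed i \<ge> 0"
    using i thetap_pos thetam_pos by (fastforce simp: speed_def idx_def split: sum.splits if_splits intro: less_imp_le)
qed

lemma site_Inl: "site t (Inl j) = kp_t P t j"
  unfolding site_def by (auto simp: start_def speed_def kp_t_def)

lemma site_Inr: "site t (Inr j) = km_t P t j"
  unfolding site_def by (auto simp: start_def speed_def km_t_def)

lemma sum_idx: "sum f idx = (\<Sum>j=1..np P. f (Inl j)) + (\<Sum>j=1..nm P. f (Inr j))"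
  by (simp add: idx_def sum.Plus o_def)

lemma h_map_eq: "h_map P t = potential idx charge (site t)"
  by (simp add: fun_eq_iff h_map_def potential_def sum_idx charge_def site_Inl site_Inr sum_negf)

lemma kp_t_less:
  assumes "t \<ge> 0" "i \<in> {1..np P}" "j \<in> {1..np P}" "i < j"
  shows "kp_t P t i < kp_t P t j"
proof -
  define K where "K = kp P (np P)"
  have i: "kp P i - K < 0"
    using kp_less[of i "np P"] assms by (simp add: K_def)
  show ?thesis
  proof (cases "j = np P")
    case True
    then show ?thesis
      using i mult_neg_pos[OF i, of "exp (- speed (Inl i) * t)"]
      unfolding site_Inl[symmetric] site_def by (simp add: K_def start_def)
  next
    case False
    have "- speed (Inl j) * t \<le> - speed (Inl i) * t"
      using speedp_mono[of i j] assms False by (simp add: mult_right_mono)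
    then have "(kp P i - K) * exp (- speed (Inl i) * t) \<le> (kp P i - K) * exp (- speed (Inl j) * t)"
      using i by (intro mult_left_mono_neg) auto
    also have "\<dots> < (kp P j - K) * exp (- speed (Inl j) * t)"
      using kp_less[of i j] assms by simp
    finally show ?thesis
      unfolding site_Inl[symmetric] site_def by (simp add: K_def start_def)
  qed
qed

lemma km_t_less:
  assumes "t \<ge> 0" "i \<in> {1..nm P}" "j \<in> {1..nm P}" "i < j"
  shows "km_t P t i < km_t P t j"
proof -
  define K where "K = kp P (np P)"
  have i: "km P i - K > 0"
    using km_gt[of i] assms by (simp add: K_def)
  have "- speed (Inr i) * t \<le> - speed (Inr j) * t"
    using speedm_antimono[of i j] assms by (simp add: mult_right_mono)
  then have "(km P i - K) * exp (- speed (Inr i) * t) \<le> (km P i - K) * exp (- speed (Inr j) * t)"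
    using i by (intro mult_left_mono) auto
  also have "\<dots> < (km P j - K) * exp (- speed (Inr j) * t)"
    using km_less[of i j] assms by simp
  finally show ?thesis
    unfolding site_Inr[symmetric] site_def by (simp add: K_def start_def)
qed

lemma kp_t_np: "kp_t P t (np P) = kp P (np P)"
  by (simp add: kp_t_def)

lemma km_t_gt: "j \<in> {1..nm P} \<Longrightarrow> km_t P t j > kp P (np P)"
  using km_gt[of j] by (simp add: km_t_def)

lemma kp_t_le: "t \<ge> 0 \<Longrightarrow> i \<in> {1..np P} \<Longrightarrow> j \<in> {1..np P} \<Longrightarrow> i \<le> j \<Longrightarrow> kp_t P t i \<le> kp_t P t j"
  using kp_t_less[of t i j] by (cases "i = j") auto

lemma km_t_le: "t \<ge> 0 \<Longrightarrow> i \<in> {1..nm P} \<Longrightarrow> j \<in> {1..nm P} \<Longrightarrow> i \<le> j \<Longrightarrow> km_t P t i \<le> km_t P t j"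
  using km_t_less[of t i j] by (cases "i = j") auto

text \<open>A point between the positive and the negative charges. It moves with \<open>t\<close> because the negative charges approach \<open>k\<^sub>N\<^sup>+\<close>.\<close>

definition divider :: "real \<Rightarrow> real" where
  "divider t = (kp P (np P) + km_t P t 1) / 2"

lemma divider: "kp P (np P) < divider t" "divider t < km_t P t 1"
  using km_t_gt[of 1 t] nm by (auto simp: divider_def)

lemma kp_t_less_divider: "t \<ge> 0 \<Longrightarrow> j \<in> {1..np P} \<Longrightarrow> kp_t P t j < divider t"
  using kp_t_le[of t j "np P"] divider(1)[of t] np by (auto simp: kp_t_np)

lemma divider_less_km_t: "t \<ge> 0 \<Longrightarrow> j \<in> {1..nm P} \<Longrightarrow> divider t < km_t P t j"
  using km_t_le[of t 1 j] divider(2)[of t] nm by auto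

lemma separated: "separated_charges idx charge (site t) (divider t)" if "t \<ge> 0"
proof
  show "finite idx"
    by (rule finite_I)
  show "idx \<noteq> {}"
    using nm by (auto simp: idx_def)
  fix i assume i: "i \<in> idx"
  then show "charge i * (site t i - divider t) < 0"
    using kp_t_less_divider[OF that] divider_less_km_t[OF that] bp_pos bm_pos
    by (auto simp: idx_def charge_def site_Inl site_Inr mult_less_0_iff)
qed

lemma inj_site: "inj_on (site t) idx" if t: "t \<ge> 0"
proof (rule inj_onI)
  have p: "i = j" if "i \<in> {1..np P}" "j \<in> {1..np P}" "kp_t P t i = kp_t P t j" for i j
    using kp_t_less[OF t that(1,2)] kp_t_less[OF t that(2,1)] that(3) by (cases i j rule: linorder_cases) auto
  have m: "i = j" if "i \<in> {1..nm P}" "j \<in> {1..nm P}" "km_t P t i = km_t P t j" for i j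
    using km_t_less[OF t that(1,2)] km_t_less[OF t that(2,1)] that(3) by (cases i j rule: linorder_cases) auto
  have pm: "kp_t P t i \<noteq> km_t P t j" if "i \<in> {1..np P}" "j \<in> {1..nm P}" for i j
    using kp_t_less_divider[OF t that(1)] divider_less_km_t[OF t that(2)] by simp
  fix x y assume xy: "x \<in> idx" "y \<in> idx" "site t x = site t y"
  then show "x = y"
  proof (cases x; cases y)
    fix i j assume [simp]: "x = Inl i" "y = Inl j"
    show ?thesis
      using xy p[of i j] by (simp add: site_Inl)
  next
    fix i j assume [simp]: "x = Inl i" "y = Inr j"
    show ?thesis
      using xy pm[of i j] by (simp add: site_Inl site_Inr)
  next
    fix i j assume [simp]: "x = Inr i" "y = Inl j"
    show ?thesis
      using xy pm[of j i] by (simp add: site_Inl site_Inr)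
  next
    fix i j assume [simp]: "x = Inr i" "y = Inr j"
    show ?thesis
      using xy m[of i j] by (simp add: site_Inr)
  qed
qed

lemma critical_point_iff:
  assumes "\<And>i. i \<in> idx \<Longrightarrow> x \<noteq> site t i"
  shows "critical_point P t x \<longleftrightarrow> efield idx charge (site t) x = 0"
proof -
  have "x \<noteq> kp_t P t j" if "j \<in> {1..np P}" for j
    using assms[of "Inl j"] that by (simp add: site_Inl)
  moreover have "x \<noteq> km_t P t j" if "j \<in> {1..nm P}" for j
    using assms[of "Inr j"] that by (simp add: site_Inr)
  ultimately have "(h_map P t has_field_derivative
           (\<Sum>j=1..np P. of_real (bp P j) / (of_real x - of_real (kp_t P t j))) -
           (\<Sum>j=1..nm P. of_real (bm P j) / (of_real x - of_real (km_t P t j))))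
         (at (of_real x) within closed_upper_half_plane)"
    by (intro h_map_has_field_derivative) (auto simp: closed_upper_half_plane_def)
  also have "(\<Sum>j=1..np P. of_real (bp P j) / (of_real x - of_real (kp_t P t j))) -
           (\<Sum>j=1..nm P. of_real (bm P j) / (of_real x - of_real (km_t P t j))) =
         (of_real (efield idx charge (site t) x) :: complex)"
    by (simp add: efield_def sum_idx charge_def site_Inl site_Inr sum_negf)
  finally have D: "(h_map P t has_field_derivative of_real (efield idx charge (site t) x))
      (at (of_real x) within closed_upper_half_plane)" .
  show ?thesis
  proof
    assume "critical_point P t x"
    from has_field_derivative_unique[OF this[unfolded critical_point_def] D]
    show "efield idx charge (site t) x = 0"
      using at_within_closed_upper_half_plane_neq_bot[of x] by simp
  next
    assume "efield idx charge (site t) x = 0"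
    with D show "critical_point P t x"
      by (simp add: critical_point_def)
  qed
qed

text \<open>The signs of \<open>\<rho> - k\<close> for the sites \<open>k\<close>, when \<open>\<rho>\<close> lies in the interval that starts at \<open>k\<^sub>\<nu>\<^sup>+\<close>, respectively at \<open>k\<^sub>\<mu>\<^sup>-\<close>.\<close>

definition sidep :: "nat \<Rightarrow> nat + nat \<Rightarrow> real" where
  "sidep \<nu> = case_sum (\<lambda>j. if j \<le> \<nu> then 1 else -1) (\<lambda>j. -1)"

definition sidem :: "nat \<Rightarrow> nat + nat \<Rightarrow> real" where
  "sidem \<mu> = case_sum (\<lambda>j. 1) (\<lambda>j. if j \<le> \<mu> then 1 else -1)"

lemma sidep_neq_0: "sidep \<nu> i \<noteq> 0" and sidem_neq_0: "sidem \<mu> i \<noteq> 0"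
  by (auto simp: sidep_def sidem_def split: sum.splits)

lemma sgn_sidep:
  assumes "t \<ge> 0" "\<nu> \<in> {1..np P - 1}" "kp_t P t \<nu> < x" "x < kp_t P t (\<nu> + 1)" "i \<in> idx"
  shows "sgn (x - site t i) = sidep \<nu> i"
proof (cases i)
  case (Inl j)
  with assms have j: "j \<in> {1..np P}" and \<nu>: "\<nu> \<in> {1..np P}" "\<nu> + 1 \<in> {1..np P}"
    by auto
  show ?thesis
  proof (cases "j \<le> \<nu>")
    case True
    with kp_t_le[OF assms(1) j \<nu>(1)] assms(3) Inl show ?thesis
      by (simp add: sidep_def site_Inl)
  next
    case False
    with kp_t_le[OF assms(1) \<nu>(2) j] assms(4) Inl show ?thesis
      by (simp add: sidep_def site_Inl)
  qed
next
  case (Inr j)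
  with assms have "\<nu> + 1 \<in> {1..np P}" "np P \<in> {1..np P}" "j \<in> {1..nm P}"
    by auto
  with assms have "x < km_t P t j"
    using kp_t_le[OF assms(1), of "\<nu> + 1" "np P"] km_t_gt[of j t] by (simp add: kp_t_np)
  with Inr show ?thesis
    by (simp add: sidep_def site_Inr)
qed

lemma sgn_sidem:
  assumes "t \<ge> 0" "\<mu> \<in> {1..nm P}" "km_t P t \<mu> < x" "\<mu> < nm P \<longrightarrow> x < km_t P t (\<mu> + 1)" "i \<in> idx"
  shows "sgn (x - site t i) = sidem \<mu> i"
proof (cases i)
  case (Inl j)
  with assms have "kp_t P t j < x"
    using kp_t_le[of t j "np P"] km_t_gt[of \<mu> t] by (auto simp: kp_t_np idx_def)
  with Inl show ?thesis
    by (simp add: sidem_def site_Inl)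
next
  case (Inr j)
  with assms have j: "j \<in> {1..nm P}"
    by simp
  show ?thesis
  proof (cases "j \<le> \<mu>")
    case True
    with km_t_le[OF assms(1) j assms(2)] assms(3) Inr show ?thesis
      by (simp add: sidem_def site_Inr)
  next
    case False
    with km_t_le[OF assms(1) _ j, of "\<mu> + 1"] assms(4) j Inr show ?thesis
      by (simp add: sidem_def site_Inr)
  qed
qed

text \<open>Two critical points with the same position among the sites coincide, so that the definite description picks the one that exists.\<close>

lemma unique_critical_point:
  assumes t: "t \<ge> 0" and ex: "\<exists>x. J x \<and> efield idx charge (site t) x = 0"
    and side: "\<And>x i. J x \<Longrightarrow> i \<in> idx \<Longrightarrow> sgn (x - site t i) = \<tau> i" "\<And>i. \<tau> i \<noteq> 0"
  shows "J (THE x. J x \<and> critical_point P t x) \<and>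
           efield idx charge (site t) (THE x. J x \<and> critical_point P t x) = 0"
proof -
  interpret separated_charges idx charge "site t" "divider t"
    by (rule separated[OF t])
  have crit: "critical_point P t x \<longleftrightarrow> efield idx charge (site t) x = 0" if "J x" for x
  proof (rule critical_point_iff)
    show "x \<noteq> site t i" if "i \<in> idx" for i
      using side(1)[OF \<open>J x\<close> that] side(2)[of i] by auto
  qed
  have "\<exists>!x. J x \<and> critical_point P t x"
  proof (rule ex_ex1I)
    show "\<exists>x. J x \<and> critical_point P t x"
    proof -
      obtain x where "J x" "efield idx charge (site t) x = 0"
        using ex by blast
      then show ?thesis
        using crit[of x] by blast
    qed
    fix x y assume x: "J x \<and> critical_point P t x" and y: "J y \<and> critical_point P t y"
    show "x = y"
    proof (rule efield_zero_unique)
      show "efield idx charge (site t) x = 0" "efield idx charge (site t) y = 0"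
        using x y crit[of x] crit[of y] by simp_all
      show "(x - site t i) * (y - site t i) > 0" if "i \<in> idx" for i
      proof -
        have "sgn (x - site t i) = sgn (y - site t i)" "sgn (x - site t i) \<noteq> 0"
          using side(1)[of x i] side(1)[of y i] side(2)[of i] x y that by simp_all
        then show ?thesis
          by (auto simp: sgn_if zero_less_mult_iff split: if_splits)
      qed
    qed
  qed
  then have "J (THE x. J x \<and> critical_point P t x) \<and> critical_point P t (THE x. J x \<and> critical_point P t x)"
    by (rule theI')
  then show ?thesis
    using crit[of "THE x. J x \<and> critical_point P t x"] by simp
qed

lemma rhop:
  assumes t: "t \<ge> 0" and \<nu>: "\<nu> \<in> {1..np P - 1}"
  shows "kp_t P t \<nu> < rhop P \<nu> t" "rhop P \<nu> t < kp_t P t (\<nu> + 1)"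
    "efield idx charge (site t) (rhop P \<nu> t) = 0"
proof -
  interpret separated_charges idx charge "site t" "divider t"
    by (rule separated[OF t])
  have \<nu>': "\<nu> \<in> {1..np P}" "\<nu> + 1 \<in> {1..np P}"
    using \<nu> by auto
  then have J: "Inl \<nu> \<in> idx" "Inl (\<nu> + 1) \<in> idx"
    by auto
  have ex: "\<exists>x. (kp_t P t \<nu> < x \<and> x < kp_t P t (\<nu> + 1)) \<and> efield idx charge (site t) x = 0"
  proof (rule efield_zero_between_poles[OF J _ inj_site[OF t]])
    show "site t (Inl \<nu>) < site t (Inl (\<nu> + 1))"
      using kp_t_less[OF t \<nu>'] by (simp add: site_Inl)
    show "divider t \<le> site t (Inl \<nu>) \<or> site t (Inl (\<nu> + 1)) \<le> divider t"
      using kp_t_less_divider[OF t \<nu>'(2)] by (simp add: site_Inl)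
    show "site t i \<le> site t (Inl \<nu>) \<or> site t (Inl (\<nu> + 1)) \<le> site t i" if "i \<in> idx" for i
    proof (cases i)
      case (Inl j)
      then show ?thesis
        using kp_t_le[OF t _ \<nu>'(1), of j] kp_t_le[OF t \<nu>'(2), of j] that
        by (cases "j \<le> \<nu>") (auto simp: site_Inl)
    next
      case (Inr j)
      then show ?thesis
        using kp_t_less_divider[OF t \<nu>'(2)] divider_less_km_t[OF t, of j] that
        by (simp add: site_Inl site_Inr)
    qed
  qed (auto simp: site_Inl)
  have side: "sgn (x - site t i) = sidep \<nu> i" if "kp_t P t \<nu> < x \<and> x < kp_t P t (\<nu> + 1)" "i \<in> idx" for x i
    using that by (intro sgn_sidep[OF t \<nu>]) auto
  have "(kp_t P t \<nu> < rhop P \<nu> t \<and> rhop P \<nu> t < kp_t P t (\<nu> + 1)) \<and>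
      efield idx charge (site t) (rhop P \<nu> t) = 0"
    unfolding rhop_def conj_assoc[symmetric]
    using t ex side sidep_neq_0 by (rule unique_critical_point)
  then show "kp_t P t \<nu> < rhop P \<nu> t" "rhop P \<nu> t < kp_t P t (\<nu> + 1)"
    "efield idx charge (site t) (rhop P \<nu> t) = 0"
    by auto
qed

lemma rhom:
  assumes t: "t \<ge> 0" and \<mu>: "\<mu> \<in> {1..nm P}"
  shows "km_t P t \<mu> < rhom P \<mu> t" "\<mu> < nm P \<longrightarrow> rhom P \<mu> t < km_t P t (\<mu> + 1)"
    "efield idx charge (site t) (rhom P \<mu> t) = 0"
proof -
  interpret separated_charges idx charge "site t" "divider t"
    by (rule separated[OF t])
  have J: "Inr \<mu> \<in> idx"
    using \<mu> by (auto simp: idx_def)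
  have le: "site t i \<le> site t (Inr \<mu>) \<or> (\<mu> < nm P \<and> site t (Inr (\<mu> + 1)) \<le> site t i)" if "i \<in> idx" for i
  proof (cases i)
    case (Inl j)
    then show ?thesis
      using kp_t_less_divider[OF t, of j] divider_less_km_t[OF t, of \<mu>] \<mu> that
      by (auto simp: site_Inl site_Inr idx_def)
  next
    case (Inr j)
    then show ?thesis
      using km_t_le[OF t, of j \<mu>] km_t_le[OF t, of "\<mu> + 1" j] \<mu> that
      by (cases "j \<le> \<mu>") (auto simp: site_Inr idx_def)
  qed
  have div: "divider t \<le> site t (Inr \<mu>)"
    using divider_less_km_t[OF t \<mu>] by (simp add: site_Inr)
  have ex: "\<exists>x. (km_t P t \<mu> < x \<and> (\<mu> < nm P \<longrightarrow> x < km_t P t (\<mu> + 1))) \<and> efield idx charge (site t) x = 0"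
  proof (cases "\<mu> < nm P")
    case True
    then have J': "Inr (\<mu> + 1) \<in> idx"
      by (auto simp: idx_def)
    show ?thesis
    proof (rule efield_zero_between_poles[OF J J' _ inj_site[OF t]])
      show "site t (Inr \<mu>) < site t (Inr (\<mu> + 1))"
        using km_t_less[OF t, of \<mu> "\<mu> + 1"] True \<mu> by (auto simp: site_Inr)
      show "site t i \<le> site t (Inr \<mu>) \<or> site t (Inr (\<mu> + 1)) \<le> site t i" if "i \<in> idx" for i
        using le[OF that] by blast
      show "divider t \<le> site t (Inr \<mu>) \<or> site t (Inr (\<mu> + 1)) \<le> divider t"
        using div by blast
    qed (auto simp: site_Inr)
  next
    case False
    have "sum charge idx > 0"
      using total by (simp add: sum_idx charge_def sum_negf bp_total_def bm_total_def)
    moreover have "site t i \<le> site t (Inr \<mu>)" if "i \<in> idx" for i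
      using le[OF that] False by blast
    ultimately obtain x where "site t (Inr \<mu>) < x" "efield idx charge (site t) x = 0"
      using efield_zero_right_of_poles[OF J inj_site[OF t] _ div] by blast
    with False show ?thesis
      by (auto simp: site_Inr)
  qed
  have side: "sgn (x - site t i) = sidem \<mu> i"
    if "km_t P t \<mu> < x \<and> (\<mu> < nm P \<longrightarrow> x < km_t P t (\<mu> + 1))" "i \<in> idx" for x i
    using that by (intro sgn_sidem[OF t \<mu>]) auto
  have "(km_t P t \<mu> < rhom P \<mu> t \<and> (\<mu> < nm P \<longrightarrow> rhom P \<mu> t < km_t P t (\<mu> + 1))) \<and>
      efield idx charge (site t) (rhom P \<mu> t) = 0"
    unfolding rhom_def conj_assoc[symmetric]
    using t ex side sidem_neq_0 by (rule unique_critical_point)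
  then show "km_t P t \<mu> < rhom P \<mu> t" "\<mu> < nm P \<longrightarrow> rhom P \<mu> t < km_t P t (\<mu> + 1)"
    "efield idx charge (site t) (rhom P \<mu> t) = 0"
    by auto
qed

lemma rate_eq:
  assumes "((\<lambda>t. height t (\<rho> t) / t) \<longlongrightarrow> L) at_top"
    and "\<And>t i. t \<ge> 0 \<Longrightarrow> i \<in> idx \<Longrightarrow> sgn (\<rho> t - site t i) = \<tau> i" "\<And>i. i \<in> idx \<Longrightarrow> \<tau> i \<noteq> 0"
  shows "rate P \<rho> = L"
  unfolding rate_def
proof (rule tendsto_Lim)
  show "((\<lambda>t. Re (h_map P t (of_real (\<rho> t))) / t) \<longlongrightarrow> L) at_top"
  proof (rule Lim_transform_eventually[OF assms(1)])
    show "\<forall>\<^sub>F t in at_top. height t (\<rho> t) / t = Re (h_map P t (of_real (\<rho> t))) / t"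
      using eventually_ge_at_top[of 0]
    proof eventually_elim
      case (elim t)
      then show ?case
        using potential_of_real[of "\<rho> t" t \<tau>] assms(2,3) by (simp add: h_map_eq)
    qed
  qed
qed simp

lemma orbit_orthogonal:
  assumes crit: "\<And>t. t \<ge> 0 \<Longrightarrow> efield idx charge (site t) (\<rho> t) = 0"
    and side: "sgn (\<rho> 0 - divider 0) = \<delta>"
    and order: "\<And>t i. t \<ge> 0 \<Longrightarrow> i \<in> idx \<Longrightarrow> sgn (\<rho> t - site t i) = \<tau> i" "\<And>i. i \<in> idx \<Longrightarrow> \<tau> i \<noteq> 0"
    and slope: "\<And>t. t \<ge> 0 \<Longrightarrow> \<delta> * (height t (\<rho> t) - height 0 (\<rho> 0)) \<le> \<delta> * L * t"
    and cont: "((\<lambda>t. height t (\<rho> t)) \<longlongrightarrow> height 0 (\<rho> 0)) (at_right 0)"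
    and \<gamma>: "\<delta> * (L - \<gamma>) < 0"
  shows "((\<lambda>t. Arg (orbit P \<gamma> \<rho> t - of_real (\<rho> 0))) \<longlongrightarrow> pi / 2) (at_right 0)"
proof (rule Lim_transform_eventually[OF orthogonal_departure[OF separated crit side order slope cont \<gamma>]])
  show "\<forall>\<^sub>F t in at_right 0. Arg (inv_into {z. Im z > 0} (potential idx charge (site 0))
             (potential idx charge (site t) (of_real (\<rho> t)) - of_real (\<gamma> * t)) - of_real (\<rho> 0)) =
           Arg (orbit P \<gamma> \<rho> t - of_real (\<rho> 0))"
    by (rule eventually_at_right_less[THEN eventually_mono])
      (simp add: orbit_def upper_half_plane_def h_map_eq)
qed auto

text \<open>Case \<open>\<delta> = - 1\<close>. The exponent \<open>\<theta>\<^sub>\<nu>\<^sup>+\<close> lies between those of the sites outside and those of the sites inside,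
  as \<open>drift_bound\<close> requires.\<close>

lemma rhop_orthogonal:
  assumes \<nu>: "\<nu> \<in> {1..np P - 1}" and \<gamma>: "\<gamma> < rate P (rhop P \<nu>)"
  shows "((\<lambda>t. Arg (orbit P \<gamma> (rhop P \<nu>) t - of_real (rhop P \<nu> 0))) \<longlongrightarrow> pi / 2) (at_right 0)"
proof -
  define \<rho> where "\<rho> = rhop P \<nu>"
  have crit: "efield idx charge (site t) (\<rho> t) = 0" if "t \<ge> 0" for t
    unfolding \<rho>_def using rhop[OF that \<nu>] by simp
  have order: "sgn (\<rho> t - site t i) = sidep \<nu> i" if "t \<ge> 0" "i \<in> idx" for t i
    unfolding \<rho>_def using rhop[OF that(1) \<nu>] that by (intro sgn_sidep \<nu>)
  have lt: "\<rho> t < kp P (np P)" if "t \<ge> 0" for t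
  proof -
    have "\<nu> + 1 \<in> {1..np P}" "np P \<in> {1..np P}"
      using \<nu> by auto
    then show ?thesis
      using rhop(2)[OF that \<nu>] kp_t_le[OF that, of "\<nu> + 1" "np P"] by (simp add: kp_t_np \<rho>_def)
  qed
  obtain L where L: "((\<lambda>t. height t (\<rho> t) / t) \<longlongrightarrow> L) at_top"
      "\<forall>t\<ge>0. - 1 * (height t (\<rho> t) - height 0 (\<rho> 0)) \<le> - 1 * L * t"
      "- 1 * L \<le> 2 * speed (Inl \<nu>) * (\<Sum>i\<in>idx. \<bar>charge i\<bar>)"
      "((\<lambda>t. height t (\<rho> t)) \<longlongrightarrow> height 0 (\<rho> 0)) (at_right 0)"
  proof (rule critical_height_slope[OF crit _ _ order sidep_neq_0])
    show "sgn (\<rho> t - kp P (np P)) = - 1" if "t \<ge> 0" for t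
      using lt[OF that] by simp
    show "speed (Inl \<nu>) \<ge> 0"
      using \<nu> by (intro \<theta>_nonneg) (auto simp: idx_def)
    fix i assume i: "i \<in> idx" "(start i - kp P (np P)) * - 1 > 0"
    then obtain j where j: "i = Inl j" "1 \<le> j" "j < np P"
      using km_gt by (fastforce simp: idx_def start_def order.order_iff_strict)
    show "speed (Inl \<nu>) \<le> speed i" if "sidep \<nu> i = - 1"
      using that j \<nu> speedp_mono[of \<nu> j] by (auto simp: sidep_def split: if_splits)
    show "speed i \<le> speed (Inl \<nu>)" if "sidep \<nu> i = - (- 1)"
      using that j \<nu> speedp_mono[of j \<nu>] by (auto simp: sidep_def split: if_splits)
  qed auto
  have "rate P \<rho> = L"
    by (rule rate_eq[OF L(1) order sidep_neq_0])
  show ?thesis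
    unfolding \<rho>_def[symmetric]
  proof (rule orbit_orthogonal[OF crit _ order sidep_neq_0 _ L(4)])
    show "sgn (\<rho> 0 - divider 0) = - 1"
      using lt[of 0] divider(1)[of 0] by simp
    show "- 1 * (L - \<gamma>) < 0"
      using \<gamma> \<open>rate P \<rho> = L\<close> by (simp add: \<rho>_def)
  qed (use L(2) in auto)
qed

text \<open>Case \<open>\<delta> = 1\<close>. For the last critical point all sites to the right of \<open>K\<close> are inner ones, so that the
  comparison exponent \<open>0\<close> is possible; it yields a rate that is at most \<open>0\<close>, hence below \<open>\<gamma>\<close>.\<close>

lemma rhom_orthogonal:
  assumes \<mu>: "\<mu> \<in> {1..nm P}" and "\<gamma> > 0" and \<gamma>: "\<mu> < nm P \<Longrightarrow> rate P (rhom P \<mu>) < \<gamma>"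
  shows "((\<lambda>t. Arg (orbit P \<gamma> (rhom P \<mu>) t - of_real (rhom P \<mu> 0))) \<longlongrightarrow> pi / 2) (at_right 0)"
proof -
  define \<rho> where "\<rho> = rhom P \<mu>"
  define \<theta>0 where "\<theta>0 = (if \<mu> < nm P then speed (Inr \<mu>) else 0)"
  have crit: "efield idx charge (site t) (\<rho> t) = 0" if "t \<ge> 0" for t
    unfolding \<rho>_def using rhom[OF that \<mu>] by simp
  have order: "sgn (\<rho> t - site t i) = sidem \<mu> i" if "t \<ge> 0" "i \<in> idx" for t i
    unfolding \<rho>_def using rhom[OF that(1) \<mu>] that by (intro sgn_sidem \<mu>)
  have gt: "\<rho> t > divider t" if "t \<ge> 0" for t
    using rhom(1)[OF that \<mu>] divider_less_km_t[OF that \<mu>] by (simp add: \<rho>_def)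
  have speed_nonneg: "speed (Inr j) \<ge> 0" if "j \<in> {1..nm P}" for j
    using that by (intro \<theta>_nonneg) (auto simp: idx_def)
  obtain L where L: "((\<lambda>t. height t (\<rho> t) / t) \<longlongrightarrow> L) at_top"
      "\<forall>t\<ge>0. 1 * (height t (\<rho> t) - height 0 (\<rho> 0)) \<le> 1 * L * t"
      "1 * L \<le> 2 * \<theta>0 * (\<Sum>i\<in>idx. \<bar>charge i\<bar>)"
      "((\<lambda>t. height t (\<rho> t)) \<longlongrightarrow> height 0 (\<rho> 0)) (at_right 0)"
  proof (rule critical_height_slope[OF crit _ _ order sidem_neq_0])
    show "sgn (\<rho> t - kp P (np P)) = 1" if "t \<ge> 0" for t
      using gt[OF that] divider(1)[of t] by simp
    show "\<theta>0 \<ge> 0"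
      using speed_nonneg[OF \<mu>] by (simp add: \<theta>0_def)
    fix i assume i: "i \<in> idx" "(start i - kp P (np P)) * 1 > 0"
    then obtain j where j: "i = Inr j" "1 \<le> j" "j \<le> nm P"
      using kp_less[of _ "np P"] by (fastforce simp: idx_def start_def order.order_iff_strict)
    show "\<theta>0 \<le> speed i" if "sidem \<mu> i = 1"
      using that j \<mu> speedm_antimono[of j \<mu>] speed_nonneg[of j] by (auto simp: sidem_def \<theta>0_def split: if_splits)
    show "speed i \<le> \<theta>0" if "sidem \<mu> i = - 1"
      using that j \<mu> speedm_antimono[of \<mu> j] by (auto simp: sidem_def \<theta>0_def split: if_splits)
  qed auto
  have "rate P \<rho> = L"
    by (rule rate_eq[OF L(1) order sidem_neq_0])
  show ?thesis
    unfolding \<rho>_def[symmetric]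
  proof (rule orbit_orthogonal[OF crit _ order sidem_neq_0 _ L(4)])
    show "sgn (\<rho> 0 - divider 0) = 1"
      using gt[of 0] by simp
    show "1 * (L - \<gamma>) < 0"
      using \<gamma> \<open>rate P \<rho> = L\<close> L(3) \<open>\<gamma> > 0\<close> by (cases "\<mu> < nm P") (auto simp: \<rho>_def \<theta>0_def)
  qed (use L(2) in auto)
qed

end

theorem theorem6p2:
  fixes P :: log_data and \<gamma> :: real
  assumes "standing_assms P"
    and "admissible P"
    and "(SUP \<mu>\<in>{1..nm P - 1}. ereal (rate P (rhom P \<mu>)))
           < (INF \<nu>\<in>{1..np P - 1}. ereal (rate P (rhop P \<nu>)))"
    and "\<gamma> > 0"
    and "(SUP \<mu>\<in>{1..nm P - 1}. ereal (rate P (rhom P \<mu>))) < ereal \<gamma>"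
    and "ereal \<gamma> < (INF \<nu>\<in>{1..np P - 1}. ereal (rate P (rhop P \<nu>)))"
  shows "(\<forall>\<nu>\<in>{1..np P - 1}.
            ((\<lambda>t. Arg (orbit P \<gamma> (rhop P \<nu>) t - of_real (rhop P \<nu> 0))) \<longlongrightarrow> pi / 2) (at_right 0)) \<and>
         (\<forall>\<mu>\<in>{1..nm P}.
            ((\<lambda>t. Arg (orbit P \<gamma> (rhom P \<mu>) t - of_real (rhom P \<mu> 0))) \<longlongrightarrow> pi / 2) (at_right 0))"
proof -
  interpret admissible_data P
    using assms(1,2) by unfold_locales (simp_all add: admissible_def)
  have "\<gamma> < rate P (rhop P \<nu>)" if "\<nu> \<in> {1..np P - 1}" for \<nu>
    using less_le_trans[OF assms(6) INF_lower[OF that]] by simp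
  moreover have "rate P (rhom P \<mu>) < \<gamma>" if "\<mu> \<in> {1..nm P}" "\<mu> < nm P" for \<mu>
    using le_less_trans[OF SUP_upper[of \<mu> "{1..nm P - 1}" "\<lambda>\<mu>. ereal (rate P (rhom P \<mu>))"] assms(5)] that by auto
  ultimately show ?thesis
    using rhop_orthogonal rhom_orthogonal assms(4) by blast
qed

end
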